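(* Let $n\ge2$. (1) For integers $k,h\ge1$ with $k\ne h$, the integral compact forms $\mathcal{E}^{1,n}_{\mathrm{I},k}$ and $\mathcal{E}^{1,n}_{\mathrm{I},h}$ are not conformally diffeomorphic. (2) If $n$ is odd, then for integers $k,h\ge0$ with $k\ne h$, the integral compact forms $\mathcal{E}^{1,n}_{\mathrm{II},k}$ and $\mathcal{E}^{1,n}_{\mathrm{II},h}$ are not conformally diffeomorphic. (3) If $n$ is odd, then for all integers $k\ge0$ and $h\ge1$, the integral compact forms $\mathcal{E}^{1,n}_{\mathrm{II},k}$ and $\mathcal{E}^{1,n}_{\mathrm{I},h}$ are not conformally diffeomorphic.
   Context: The Einstein static universe is $\mathcal{E}^{1,n}=\{(\tau,\mathrm{y})\in\mathbb{R}\times\mathbb{R}^{n+1}\mid{}^t\mathrm{y}\mathrm{y}=1\}=\mathbb{R}\times\mathbb{S}^n$ with the Lorentz metric $-d\tau^2+g_{\mathbb{S}^n}$ ($g_{\mathbb{S}^n}$ the standard round metric), time-oriented by requiring $\partial_\tau$ to be future-directed, and with the product orientation. For an integer $k\ge1$, the integral compact form of the first kind with index $k$, $\mathcal{E}^{1,n}_{\mathrm{I},k}$, is the quotient of $\mathcal{E}^{1,n}$ by the group generated by $(\tau,\mathrm{y})\mapsto(\tau+2k\pi,\mathrm{y})$. For $n$ odd and an integer $k\ge0$, the integral compact form of the second kind with index $k$, $\mathcal{E}^{1,n}_{\mathrm{II},k}$, is the quotient of $\mathcal{E}^{1,n}$ by the group generated by $(\tau,\mathrm{y})\mapsto(\tau+(2k+1)\pi,-\mathrm{y})$.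 These quotients carry the unique Lorentz metric, orientation and time-orientation making the covering map a local isometry preserving orientation and time-orientation. *)

theory Defs
  imports
    "HOL-Analysis.Analysis"
    "HOL-Algebra.Group_Action"
    "HOL-Algebra.Elementary_Groups"
    "HOL-Algebra.Bij"
begin

text \<open>Meaningful for open sets \<open>S\<close>, where \<open>ck_on k S f\<close> says that \<open>f\<close> is of class \<open>C\<^sup>k\<close>.\<close>

primrec ck_on :: "nat \<Rightarrow> 'a::euclidean_space set \<Rightarrow> ('a \<Rightarrow> 'b::euclidean_space) \<Rightarrow> bool" where
  "ck_on 0 S f \<longleftrightarrow> continuous_on S f"
| "ck_on (Suc k) S f \<longleftrightarrow>
     (\<forall>x\<in>S. f differentiable (at x)) \<and> (\<forall>v. ck_on k S (\<lambda>x. frechet_derivative f (at x) v))"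

text \<open>On an arbitrary subset, smooth means locally extendable to a smooth map on an open set of the
  ambient space. For open \<open>S\<close> this is smoothness in the usual sense.\<close>

definition smooth_on :: "'a::euclidean_space set \<Rightarrow> ('a \<Rightarrow> 'b::euclidean_space) \<Rightarrow> bool" where
  "smooth_on S f \<longleftrightarrow>
     (\<forall>x\<in>S. \<exists>V F. open V \<and> x \<in> V \<and> (\<forall>k. ck_on k V F) \<and> (\<forall>z\<in>S \<inter> V. F z = f z))"

text \<open>A chart is recorded by its inverse, a parametrization of an open subset of the manifold by an
  open subset of the model space, together with the metric in these coordinates:
  \<open>metric_coeff c x v w\<close> is the value at the point \<open>param c x\<close> of the metric on the tangent vectors
  with coordinates \<open>v\<close> and \<open>w\<close>. Values of \<open>param c\<close> and \<open>metric_coeff c\<close> outside \<open>coord_dom c\<close> are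
  irrelevant.\<close>

record ('v, 'p) metric_chart =
  coord_dom :: "'v set"
  param :: "'v \<Rightarrow> 'p"
  metric_coeff :: "'v \<Rightarrow> 'v \<Rightarrow> 'v \<Rightarrow> real"

type_synonym ('v, 'p) metric_atlas = "('v, 'p) metric_chart set"

definition points :: "('v, 'p) metric_atlas \<Rightarrow> 'p set" where
  "points A = (\<Union>c\<in>A. param c ` coord_dom c)"

definition rep_dom ::
  "('v, 'p) metric_chart \<Rightarrow> ('w, 'q) metric_chart \<Rightarrow> ('p \<Rightarrow> 'q) \<Rightarrow> 'v set" where
  "rep_dom c d f = {x \<in> coord_dom c. f (param c x) \<in> param d ` coord_dom d}"

definition coord_rep ::
  "('v, 'p) metric_chart \<Rightarrow> ('w, 'q) metric_chart \<Rightarrow> ('p \<Rightarrow> 'q) \<Rightarrow> 'v \<Rightarrow> 'w" where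
  "coord_rep c d f x = inv_into (coord_dom d) (param d) (f (param c x))"

text \<open>Openness of the domains of the coordinate representations expresses continuity.\<close>

definition smooth_map ::
  "('v::euclidean_space, 'p) metric_atlas \<Rightarrow> ('w::euclidean_space, 'q) metric_atlas \<Rightarrow>
    ('p \<Rightarrow> 'q) \<Rightarrow> bool" where
  "smooth_map A B f \<longleftrightarrow> f ` points A \<subseteq> points B \<and>
     (\<forall>c\<in>A. \<forall>d\<in>B. open (rep_dom c d f) \<and> smooth_on (rep_dom c d f) (coord_rep c d f))"

definition diffeomorphism ::
  "('v::euclidean_space, 'p) metric_atlas \<Rightarrow> ('w::euclidean_space, 'q) metric_atlas \<Rightarrow>
    ('p \<Rightarrow> 'q) \<Rightarrow> bool" where
  "diffeomorphism A B f \<longleftrightarrow> bij_betw f (points A) (points B) \<and>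
     smooth_map A B f \<and> smooth_map B A (inv_into (points A) f)"

text \<open>A diffeomorphism is conformal if the pull-back of the metric of the target is the metric of
  the source multiplied by a positive smooth function \<open>\<mu>\<close>. It need not preserve an orientation or a
  time-orientation, so these are not recorded in the atlases.\<close>

definition conformal_diffeomorphism ::
  "('v::euclidean_space, 'p) metric_atlas \<Rightarrow> ('w::euclidean_space, 'q) metric_atlas \<Rightarrow>
    ('p \<Rightarrow> 'q) \<Rightarrow> bool" where
  "conformal_diffeomorphism A B f \<longleftrightarrow> diffeomorphism A B f \<and>
     (\<exists>\<mu> :: 'p \<Rightarrow> real.
        (\<forall>p\<in>points A. \<mu> p > 0) \<and>
        (\<forall>c\<in>A. smooth_on (coord_dom c) (\<mu> \<circ> param c)) \<and>
        (\<forall>c\<in>A. \<forall>d\<in>B. \<forall>x\<in>rep_dom c d f. \<forall>v w.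
           metric_coeff d (coord_rep c d f x)
             (frechet_derivative (coord_rep c d f) (at x) v)
             (frechet_derivative (coord_rep c d f) (at x) w)
           = \<mu> (param c x) * metric_coeff c x v w))"

definition conformally_diffeomorphic ::
  "('v::euclidean_space, 'p) metric_atlas \<Rightarrow> ('w::euclidean_space, 'q) metric_atlas \<Rightarrow> bool" where
  "conformally_diffeomorphic A B \<longleftrightarrow> (\<exists>f. conformal_diffeomorphism A B f)"

text \<open>The quotient by a group \<open>G\<close> of isometries acting freely and properly discontinuously via \<open>\<phi>\<close>.
  Its points are the orbits. Its charts are those charts of the manifold on which the projection to
  the orbit space is injective; since they keep their metric coefficients, the projection is a
  local isometry.\<close>

definition quotient_atlas ::
  "('g, 'm) monoid_scheme \<Rightarrow> ('g \<Rightarrow> 'p \<Rightarrow> 'p) \<Rightarrow> ('v, 'p) metric_atlas \<Rightarrow> ('v, 'p set) metric_atlas"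
where
  "quotient_atlas G \<phi> A =
     {\<lparr>coord_dom = coord_dom c, param = orbit G \<phi> \<circ> param c, metric_coeff = metric_coeff c\<rparr> |c.
        c \<in> A \<and> inj_on (orbit G \<phi> \<circ> param c) (coord_dom c)}"

text \<open>If \<open>'a\<close> has dimension \<open>n + 1\<close>, then \<open>einstein\<close> is \<open>\<real> \<times> S\<^sup>n\<close>. It has dimension \<open>n + 1\<close> as well, so
  \<open>'a\<close> also serves as the model space for its charts.\<close>

definition einstein :: "(real \<times> 'a::euclidean_space) set" where
  "einstein = {(\<tau>, y). y \<bullet> y = 1}"

text \<open>The form \<open>- d\<tau>\<^sup>2 + dy\<^sup>2\<close> on the ambient space; its restriction to the tangent spaces of
  \<open>einstein\<close> is the Lorentz metric \<open>- d\<tau>\<^sup>2\<close> plus the round metric.\<close>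

definition lorentz_form :: "real \<times> 'a::euclidean_space \<Rightarrow> real \<times> 'a \<Rightarrow> real" where
  "lorentz_form v w = - (fst v * fst w) + snd v \<bullet> snd w"

text \<open>All smooth charts of \<open>einstein\<close> as a submanifold of the ambient space, with the metric
  induced by \<open>lorentz_form\<close>.\<close>

definition einstein_atlas :: "('a::euclidean_space, real \<times> 'a) metric_atlas" where
  "einstein_atlas =
     {\<lparr>coord_dom = W, param = \<psi>,
       metric_coeff = (\<lambda>x v w. lorentz_form (frechet_derivative \<psi> (at x) v)
                                            (frechet_derivative \<psi> (at x) w))\<rparr> |W \<psi>.
        open W \<and> smooth_on W \<psi> \<and>
        (\<exists>U \<phi>. openin (top_of_set einstein) U \<and> homeomorphism W U \<psi> \<phi> \<and> smooth_on U \<phi>)}"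

definition generated_transformation_group ::
  "(real \<times> 'a::euclidean_space \<Rightarrow> real \<times> 'a) \<Rightarrow> (real \<times> 'a \<Rightarrow> real \<times> 'a) monoid" where
  "generated_transformation_group T = subgroup_generated (BijGroup einstein) {restrict T einstein}"

type_synonym 'a einstein_quotient = "('a, (real \<times> 'a) set) metric_atlas"

definition compact_form_I :: "nat \<Rightarrow> 'a::euclidean_space einstein_quotient" where
  "compact_form_I k =
     quotient_atlas (generated_transformation_group (\<lambda>(\<tau>, y). (\<tau> + 2 * real k * pi, y)))
       (\<lambda>g. g) einstein_atlas"

definition compact_form_II :: "nat \<Rightarrow> 'a::euclidean_space einstein_quotient" where
  "compact_form_II k =
     quotient_atlas (generated_transformation_group (\<lambda>(\<tau>, y). (\<tau> + (2 * real k + 1) * pi, - y)))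
       (\<lambda>g. g) einstein_atlas"

end

theory Submission
  imports Defs
begin

text \<open>Both families are quotients of the Einstein universe by the group generated by a power
  \<open>\<sigma>\<^sup>m\<close> of \<open>\<sigma>(\<tau>, y) = (\<tau> + \<pi>, - y)\<close>, with \<open>m = 2 k\<close> for the first kind and \<open>m = 2 k + 1\<close> for the
  second. Since \<open>n \<ge> 2\<close>, the Einstein universe is simply connected, and a conformal diffeomorphism
  between the quotients by \<open>\<sigma>\<^sup>m\<close> and \<open>\<sigma>\<^sup>l\<close> lifts to a homeomorphism \<open>F\<close> of it. The lift maps timelike
  curves to timelike curves, hence it preserves or reverses the chronology relation. But \<open>\<sigma>\<close> is
  determined by this relation, as the past of \<open>\<sigma>(x)\<close> is the complement of the causal future of \<open>x\<close>.
  So \<open>F \<sigma> = \<sigma>\<^sup>e F\<close> with \<open>e = 1\<close> or \<open>e = - 1\<close>, and comparing the deck transformations gives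
  \<open>l dvd m\<close> and \<open>m dvd l\<close>.\<close>

section \<open>The chronology relation on the Einstein universe\<close>

text \<open>Conformality enters through the sign of the Lorentz form on velocities: the factor is
  positive, so a velocity is timelike exactly when its image is. To exploit this,
  \<open>chron\<close> is a closed formula comparing elapsed time with spherical distance, and it is
  tied to curves in two ways: a timelike curve relates its end points, and related points are joined
  by an explicit timelike curve. The map may reverse time, and the sign could a priori vary from
  pair to pair; it is uniform because the set of related pairs is connected. The definition gives
  conformality for the map and smoothness for its inverse. The lift \<open>G\<close> of the inverse
  is therefore controlled through the lift \<open>F\<close>: the composites are powers of
  \<open>sig\<close>, which are isometries, and this makes \<open>F\<close> respect
  \<open>chron\<close> in both directions. Orbits carry no topology here, so the lift does not come
  from a covering theorem. Orbits are separated by continuous functions, one of them with values in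
  the circle, and a continuous logarithm of that one supplies the time coordinate of the
  lift.\<close>

text \<open>\<open>sig 1\<close> maps a point to the one where all null geodesics issuing from it first meet again.\<close>

definition sig :: "int \<Rightarrow> real \<times> 'a::real_vector \<Rightarrow> real \<times> 'a" where
  "sig j x = (fst x + of_int j * pi, if even j then snd x else - snd x)"

text \<open>The chronology relation: \<open>y\<close> can be reached from \<open>x\<close> along a future-directed timelike curve.\<close>

definition chron :: "real \<times> 'a::euclidean_space \<Rightarrow> real \<times> 'a \<Rightarrow> bool" where
  "chron x y \<longleftrightarrow> arccos (snd x \<bullet> snd y) < fst y - fst x"

lemma einstein_iff: "x \<in> einstein \<longleftrightarrow> snd x \<bullet> snd x = 1"
  by (cases x) (simp add: einstein_def)

lemma norm_snd_einstein: "x \<in> einstein \<Longrightarrow> norm (snd x) = 1"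
  by (simp add: einstein_iff norm_eq_1)

lemma sig_0 [simp]: "sig 0 x = x"
  by (simp add: sig_def)

lemma sig_sig: "sig i (sig j x) = sig (i + j) x"
  by (auto simp: sig_def algebra_simps)

lemma sig_einstein [simp]: "sig j x \<in> einstein \<longleftrightarrow> x \<in> einstein"
  by (simp add: sig_def einstein_iff)

lemma sig_inject [simp]: "sig i x = sig j x \<longleftrightarrow> i = j"
  by (auto simp: sig_def)

lemma fst_sig [simp]: "fst (sig j x) = fst x + of_int j * pi"
  by (simp add: sig_def)

lemma chron_sig [simp]: "chron (sig j x) (sig j y) \<longleftrightarrow> chron x y"
  by (auto simp: chron_def sig_def)

lemma unit_inner_bounds:
  assumes "u \<bullet> u = 1" "v \<bullet> v = 1"
  shows "-1 \<le> u \<bullet> v" "u \<bullet> v \<le> (1::real)"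
  using Cauchy_Schwarz_ineq2[of u v] assms by (auto simp: norm_eq_sqrt_inner)

lemma unit_arccos_bounds:
  assumes "u \<bullet> u = 1" "v \<bullet> v = 1"
  shows "0 \<le> arccos (u \<bullet> v)" "arccos (u \<bullet> v) \<le> pi" "cos (arccos (u \<bullet> v)) = u \<bullet> v"
  using unit_inner_bounds[OF assms] by (auto intro: arccos_lbound arccos_ubound cos_arccos)

text \<open>\<open>e\<close> is the initial direction of a great circle arc from \<open>u\<close> to
  \<open>v\<close>: the component of \<open>v\<close> orthogonal to \<open>u\<close>, normalised by
  its length \<open>s\<close>. If \<open>v\<close> is \<open>u\<close> or \<open>- u\<close>, this
  component vanishes and any unit vector orthogonal to \<open>u\<close> serves; this is the use of
  dimension at least 2.\<close>

lemma unit_vector_decomposition: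
  fixes u v :: "'a::euclidean_space"
  assumes "u \<bullet> u = 1" "v \<bullet> v = 1" "2 \<le> DIM('a)"
  obtains e where "e \<bullet> e = 1" "u \<bullet> e = 0"
    "v = cos (arccos (u \<bullet> v)) *\<^sub>R u + sin (arccos (u \<bullet> v)) *\<^sub>R e"
proof -
  define c where "c = u \<bullet> v"
  define s where "s = sin (arccos c)"
  have c: "cos (arccos c) = c" using unit_arccos_bounds[OF assms(1,2)] by (simp add: c_def)
  have s2: "s\<^sup>2 = 1 - c\<^sup>2" using sin_cos_squared_add[of "arccos c"] c by (simp add: s_def)
  have sq: "(v - c *\<^sub>R u) \<bullet> (v - c *\<^sub>R u) = s\<^sup>2"
    using assms s2 by (simp add: inner_diff inner_commute c_def power2_eq_square)
  show ?thesis
  proof (cases "s = 0")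
    case True
    then have "v = c *\<^sub>R u" using sq by simp
    moreover obtain e0 where e0: "e0 \<noteq> 0" "orthogonal u e0"
      using orthogonal_to_vector_exists[OF assms(3), of u] by blast
    ultimately show ?thesis
      using that[of "e0 /\<^sub>R norm e0"] True c
      by (simp add: s_def c_def orthogonal_def dot_square_norm power2_eq_square)
  next
    case False
    show ?thesis
    proof (rule that[of "(v - c *\<^sub>R u) /\<^sub>R s"])
      show "((v - c *\<^sub>R u) /\<^sub>R s) \<bullet> ((v - c *\<^sub>R u) /\<^sub>R s) = 1"
        using sq False by (simp only: inner_scaleR_left inner_scaleR_right) (simp add: power2_eq_square divide_simps)
      show "u \<bullet> ((v - c *\<^sub>R u) /\<^sub>R s) = 0"
        using assms by (simp add: inner_diff c_def)
      show "v = cos (arccos (u \<bullet> v)) *\<^sub>R u + sin (arccos (u \<bullet> v)) *\<^sub>R ((v - c *\<^sub>R u) /\<^sub>R s)"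
        using False c by (simp flip: c_def s_def)
    qed
  qed
qed

text \<open>Both arcs are written from the middle vertex \<open>v\<close>. The cosine law then gives
  \<open>u \<bullet> w\<close> as a function of \<open>e \<bullet> f\<close>, smallest at
  \<open>e \<bullet> f = - 1\<close>, where the two arcs continue each other and the value is
  \<open>cos (a + b)\<close>.\<close>

lemma arccos_triangle:
  fixes u v w :: "'a::euclidean_space"
  assumes "u \<bullet> u = 1" "v \<bullet> v = 1" "w \<bullet> w = 1" "2 \<le> DIM('a)"
  shows "arccos (u \<bullet> w) \<le> arccos (u \<bullet> v) + arccos (v \<bullet> w)"
proof -
  define a where "a = arccos (v \<bullet> u)"
  define b where "b = arccos (v \<bullet> w)"
  have ab: "0 \<le> a" "a \<le> pi" "0 \<le> b" "b \<le> pi"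
    using unit_arccos_bounds assms by (auto simp: a_def b_def)
  obtain e where e: "e \<bullet> e = 1" "v \<bullet> e = 0" "u = cos a *\<^sub>R v + sin a *\<^sub>R e"
    using unit_vector_decomposition[OF assms(2,1,4)] unfolding a_def by metis
  obtain f where f: "f \<bullet> f = 1" "v \<bullet> f = 0" "w = cos b *\<^sub>R v + sin b *\<^sub>R f"
    using unit_vector_decomposition[OF assms(2,3,4)] unfolding b_def by metis
  have "u \<bullet> w = cos a * cos b + sin a * sin b * (e \<bullet> f)"
    using e f assms by (simp add: inner_add inner_commute)
  moreover have "sin a * sin b * (e \<bullet> f) \<ge> sin a * sin b * (-1)"
    using ab unit_inner_bounds[OF e(1) f(1)]
    by (intro mult_left_mono) (auto intro!: mult_nonneg_nonneg sin_ge_zero)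
  ultimately have *: "cos (a + b) \<le> u \<bullet> w" by (simp add: cos_add)
  have "arccos (u \<bullet> w) \<le> a + b"
  \<comment> \<open>\<open>arccos\<close> inverts \<open>cos\<close> on angles up to
    \<open>pi\<close>; a larger sum exceeds every spherical distance.\<close>
  proof (cases "a + b \<le> pi")
    case True
    have "arccos (u \<bullet> w) \<le> arccos (cos (a + b))"
      using * unit_inner_bounds[OF assms(1,3)] by (intro arccos_le_arccos) auto
    then show ?thesis using True ab by (simp add: arccos_cos)
  next
    case False
    then show ?thesis using unit_arccos_bounds[OF assms(1,3)] by linarith
  qed
  then show ?thesis by (simp add: a_def b_def inner_commute)
qed

lemma chron_trans:
  fixes x y z :: "real \<times> 'a::euclidean_space"
  assumes "chron x y" "chron y z" "x \<in> einstein" "y \<in> einstein" "z \<in> einstein" "2 \<le> DIM('a)"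
  shows "chron x z"
  using assms arccos_triangle[of "snd x" "snd y" "snd z"] by (auto simp: chron_def einstein_iff)

lemma chron_imp_less:
  assumes "chron x y" "x \<in> einstein" "y \<in> einstein"
  shows "fst x < fst y"
  using assms unit_arccos_bounds[of "snd x" "snd y"] by (auto simp: chron_def einstein_iff)

text \<open>The past of \<open>sig 1 x\<close> is the complement of the causal future of \<open>x\<close>; this describes \<open>sig 1\<close> in
  terms of the chronology relation alone.\<close>

lemma chron_sig_1_iff:
  fixes x z :: "real \<times> 'a::euclidean_space"
  assumes "x \<in> einstein" "z \<in> einstein" "2 \<le> DIM('a)"
  shows "chron z (sig 1 x) \<longleftrightarrow> (\<exists>w\<in>einstein. chron z w \<and> \<not> chron x w)"
proof -
  have xz: "snd x \<bullet> snd x = 1" "snd z \<bullet> snd z = 1" using assms by (auto simp: einstein_iff)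
  let ?d = "arccos (snd x \<bullet> snd z)"
  have 1: "chron z (sig 1 x) \<longleftrightarrow> fst z - fst x < ?d"
    using unit_inner_bounds[OF xz]
    by (auto simp: chron_def sig_def arccos_minus inner_commute)
  have "(\<exists>w\<in>einstein. chron z w \<and> \<not> chron x w) \<longleftrightarrow> fst z - fst x < ?d"
  proof
    assume "\<exists>w\<in>einstein. chron z w \<and> \<not> chron x w"
    then obtain w where "w \<in> einstein" "chron z w" "\<not> chron x w" by blast
    then show "fst z - fst x < ?d"
      using arccos_triangle[OF xz, of "snd w"] assms by (auto simp: chron_def einstein_iff)
  next
    assume "fst z - fst x < ?d"
    then show "\<exists>w\<in>einstein. chron z w \<and> \<not> chron x w"
      using xz by (intro bexI[of _ "(fst x + ?d, snd z)"]) (auto simp: chron_def einstein_iff)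
  qed
  with 1 show ?thesis by simp
qed

text \<open>Inclusion of the past of \<open>a\<close> in the past of \<open>b\<close> already gives
  the causal inequality \<open>le\<close>, by testing with points slightly earlier than
  \<open>a\<close> on the same vertical line. Applied both ways, it forces equal times and zero
  distance.\<close>

lemma chron_past_distinguishing:
  fixes x y :: "real \<times> 'a::euclidean_space"
  assumes "x \<in> einstein" "y \<in> einstein"
    and "\<And>z. z \<in> einstein \<Longrightarrow> chron z x \<longleftrightarrow> chron z y"
  shows "x = y"
proof -
  have le: "arccos (snd a \<bullet> snd b) \<le> fst b - fst a"
    if "a \<in> einstein" and ab: "\<And>z. z \<in> einstein \<Longrightarrow> chron z a \<Longrightarrow> chron z b"
    for a b :: "real \<times> 'a"
  proof (rule field_le_epsilon)
    fix e :: real assume "0 < e"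
    then show "arccos (snd a \<bullet> snd b) \<le> fst b - fst a + e"
      using ab[of "(fst a - e, snd a)"] that(1) by (auto simp: chron_def einstein_iff)
  qed
  have "arccos (snd x \<bullet> snd y) \<le> fst y - fst x" "arccos (snd x \<bullet> snd y) \<le> fst x - fst y"
    using le[of x y] le[of y x] assms by (auto simp: inner_commute)
  moreover have xy: "snd x \<bullet> snd x = 1" "snd y \<bullet> snd y = 1" using assms by (auto simp: einstein_iff)
  ultimately have "fst x = fst y" "arccos (snd x \<bullet> snd y) = 0"
    using unit_arccos_bounds[OF xy] by linarith+
  moreover from this have "snd x \<bullet> snd y = 1" using unit_arccos_bounds[OF xy] by simp
  then have "(snd x - snd y) \<bullet> (snd x - snd y) = 0"
    using xy by (simp add: inner_diff inner_commute)
  ultimately show ?thesis by (auto simp: prod_eq_iff)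
qed

text \<open>By \<open>chron_sig_1_iff\<close> the past of \<open>sig 1 x\<close> is described by
  \<open>chron\<close> and a quantifier over \<open>einstein\<close>, so every surjection respecting
  \<open>chron\<close> carries it along; and a point is determined by its past.\<close>

lemma chron_automorphism_commutes_sig:
  fixes H :: "real \<times> 'a::euclidean_space \<Rightarrow> real \<times> 'a"
  assumes H: "H ` einstein = einstein"
    and iff: "\<And>p q. p \<in> einstein \<Longrightarrow> q \<in> einstein \<Longrightarrow> chron (H p) (H q) \<longleftrightarrow> chron p q"
    and x: "x \<in> einstein" and dim: "2 \<le> DIM('a)"
  shows "H (sig 1 x) = sig 1 (H x)"
proof (rule chron_past_distinguishing)
  have He: "H z \<in> einstein" if "z \<in> einstein" for z using that H by blast
  show "H (sig 1 x) \<in> einstein" "sig 1 (H x) \<in> einstein" using x He by auto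
  fix z' :: "real \<times> 'a" assume "z' \<in> einstein"
  then obtain z where z: "z \<in> einstein" "z' = H z" using H by blast
  have "chron z' (H (sig 1 x)) \<longleftrightarrow> (\<exists>w\<in>einstein. chron z w \<and> \<not> chron x w)"
    using z x iff dim by (simp add: chron_sig_1_iff)
  also have "\<dots> \<longleftrightarrow> (\<exists>w\<in>einstein. chron (H z) (H w) \<and> \<not> chron (H x) (H w))"
    using z x iff by blast
  also have "\<dots> \<longleftrightarrow> (\<exists>w'\<in>H ` einstein. chron (H z) w' \<and> \<not> chron (H x) w')" by blast
  also have "\<dots> \<longleftrightarrow> chron z' (sig 1 (H x))"
    using z x He dim by (simp add: chron_sig_1_iff H)
  finally show "chron z' (H (sig 1 x)) \<longleftrightarrow> chron z' (sig 1 (H x))" .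
qed

lemma sig_power_commutes:
  assumes step: "\<And>x. x \<in> einstein \<Longrightarrow> H (sig 1 x) = sig e (H x)" and x: "x \<in> einstein"
  shows "H (sig j x) = sig (e * j) (H x)"
proof (induction j rule: int_induct[of _ 0])
  case base
  then show ?case by simp
next
  case (step1 i)
  have "H (sig (i + 1) x) = H (sig 1 (sig i x))" by (simp add: sig_sig add.commute)
  also have "\<dots> = sig e (H (sig i x))" using x by (intro step) simp
  also have "\<dots> = sig (e * (i + 1)) (H x)" using step1 by (simp add: sig_sig distrib_left add.commute)
  finally show ?case .
next
  case (step2 i)
  have "H (sig i x) = H (sig 1 (sig (i - 1) x))" by (simp add: sig_sig)
  also have "\<dots> = sig e (H (sig (i - 1) x))" using x by (simp add: step)
  \<comment> \<open>The hypothesis speaks of \<open>sig 1\<close> alone, so going down means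
    applying it one step lower and cancelling \<open>sig e\<close>.\<close>
  finally have "sig (- e) (sig e (H (sig (i - 1) x))) = sig (- e) (sig (e * i) (H x))"
    using step2 by simp
  then show ?case by (simp add: sig_sig algebra_simps)
qed

text \<open>Composing with this map turns a map reversing \<open>chron\<close> into one preserving
  it. It conjugates \<open>sig 1\<close> to \<open>sig (- 1)\<close>, which is the origin of the
  exponent \<open>- 1\<close>.\<close>

definition time_reversal :: "real \<times> 'a \<Rightarrow> real \<times> 'a" where
  "time_reversal x = (- fst x, snd x)"

lemma chron_time_reversal: "chron (time_reversal x) (time_reversal y) \<longleftrightarrow> chron y x"
  by (auto simp: chron_def time_reversal_def inner_commute)

lemma time_reversal_sig: "time_reversal (sig j x) = sig (- j) (time_reversal x)"
  by (auto simp: sig_def time_reversal_def)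

lemma time_reversal_idem [simp]: "time_reversal (time_reversal x) = x"
  by (simp add: time_reversal_def)

lemma time_reversal_einstein [simp]: "time_reversal x \<in> einstein \<longleftrightarrow> x \<in> einstein"
  by (simp add: time_reversal_def einstein_iff)

lemma chron_monotone_commutes_sig:
  fixes H :: "real \<times> 'a::euclidean_space \<Rightarrow> real \<times> 'a"
  assumes H: "H ` einstein = einstein" and dim: "2 \<le> DIM('a)"
    and "(\<forall>p\<in>einstein. \<forall>q\<in>einstein. chron (H p) (H q) \<longleftrightarrow> chron p q) \<or>
         (\<forall>p\<in>einstein. \<forall>q\<in>einstein. chron (H p) (H q) \<longleftrightarrow> chron q p)"
  obtains e where "\<bar>e\<bar> = 1" "\<And>j x. x \<in> einstein \<Longrightarrow> H (sig j x) = sig (e * j) (H x)"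
  using assms(3)
proof
  assume "\<forall>p\<in>einstein. \<forall>q\<in>einstein. chron (H p) (H q) \<longleftrightarrow> chron p q"
  then have "H (sig 1 x) = sig 1 (H x)" if "x \<in> einstein" for x
    using chron_automorphism_commutes_sig[OF H _ that dim] by blast
  then show thesis by (intro that[of 1] sig_power_commutes) auto
next
  assume rev: "\<forall>p\<in>einstein. \<forall>q\<in>einstein. chron (H p) (H q) \<longleftrightarrow> chron q p"
  have "(time_reversal \<circ> H) ` einstein = einstein"
  proof -
    have "time_reversal ` einstein = (einstein :: (real \<times> 'a) set)"
      by (metis (no_types, lifting) image_eqI subsetI subset_antisym image_subsetI time_reversal_einstein
          time_reversal_idem)
    then show ?thesis using H by (simp only: image_comp[symmetric])
  qed
  then have *: "(time_reversal \<circ> H) (sig 1 x) = sig 1 ((time_reversal \<circ> H) x)" if "x \<in> einstein" for x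
    using rev that dim by (intro chron_automorphism_commutes_sig) (auto simp: chron_time_reversal)
  have "H (sig 1 x) = sig (- 1) (H x)" if "x \<in> einstein" for x
    using arg_cong[OF *[OF that], of time_reversal] by (simp add: time_reversal_sig)
  then show thesis by (intro that[of "-1"] sig_power_commutes) auto
qed

section \<open>Timelike curves and the chronology relation\<close>

lemma chron_local_on_curve:
  fixes \<gamma> :: "real \<Rightarrow> real \<times> 'a::euclidean_space"
  assumes \<gamma>: "\<And>s. \<gamma> s \<in> einstein" and der: "(\<gamma> has_vector_derivative v) (at s)"
    and v: "norm (snd v) < fst v"
  obtains d where "d > 0" "\<And>h. 0 < h \<Longrightarrow> h < d \<Longrightarrow> chron (\<gamma> s) (\<gamma> (s + h)) \<and> chron (\<gamma> (s - h)) (\<gamma> s)"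
proof -
  \<comment> \<open>A quarter of the gap between time speed and space speed leaves
    \<open>norm (snd v) < a < b < fst v\<close>. At parameter distance \<open>h\<close> from
    \<open>s\<close>, for small \<open>h\<close>, the chord on the sphere is at most
    \<open>a * h\<close> and the elapsed time at least \<open>b * h\<close>; the room between
    \<open>a\<close> and \<open>b\<close> pays for replacing the chord by the arc.\<close>
  define e where "e = (fst v - norm (snd v)) / 4"
  define a where "a = norm (snd v) + e"
  define b where "b = fst v - e"
  have e: "e > 0" and ab: "0 < a" "a < b"
    using v norm_ge_zero[of "snd v"] unfolding e_def a_def b_def by (argo, argo, argo)
  obtain d1 where d1: "d1 > 0"
    "\<And>y. \<bar>y - s\<bar> < d1 \<Longrightarrow> norm (\<gamma> y - \<gamma> s - (y - s) *\<^sub>R v) \<le> e * \<bar>y - s\<bar>"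
    using der e unfolding has_vector_derivative_def has_derivative_at_alt by auto
  \<comment> \<open>The derivative at 0 is \<open>b / a - 1 > 0\<close>, so for small positive
    arguments \<open>arcsin\<close> stays below the line of slope \<open>b / a\<close>.\<close>
  have "((\<lambda>x. (b / a) * x - arcsin x) has_real_derivative (b / a) - inverse (sqrt (1 - 0\<^sup>2))) (at 0)"
    by (intro derivative_eq_intros | simp)+
  then obtain d2 where d2: "d2 > 0" "\<And>h. 0 < h \<Longrightarrow> h < d2 \<Longrightarrow> arcsin h < (b / a) * h"
    using DERIV_pos_inc_right[of "\<lambda>x. (b / a) * x - arcsin x" "b / a - 1" 0] ab
    by (auto simp: field_simps)
  have main: "arccos (snd (\<gamma> s) \<bullet> snd (\<gamma> y)) < b * \<bar>y - s\<bar> \<and> \<bar>(fst (\<gamma> y) - fst (\<gamma> s)) - (y - s) * fst v\<bar> \<le> e * \<bar>y - s\<bar>"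
    if y: "y \<noteq> s" "\<bar>y - s\<bar> < d1" "\<bar>y - s\<bar> < d2 / a" for y
  proof
    let ?D = "\<gamma> y - \<gamma> s - (y - s) *\<^sub>R v"
    have D: "norm ?D \<le> e * \<bar>y - s\<bar>" using d1 y by blast
    show "\<bar>(fst (\<gamma> y) - fst (\<gamma> s)) - (y - s) * fst v\<bar> \<le> e * \<bar>y - s\<bar>"
      using order_trans[OF norm_fst_le[of "fst ?D" "snd ?D", unfolded prod.collapse] D] by simp
    have "norm (snd (\<gamma> y) - snd (\<gamma> s) - (y - s) *\<^sub>R snd v) \<le> e * \<bar>y - s\<bar>"
      using order_trans[OF norm_snd_le[of "snd ?D" "fst ?D", unfolded prod.collapse] D] by simp
    then have "norm (snd (\<gamma> y) - snd (\<gamma> s)) \<le> e * \<bar>y - s\<bar> + norm ((y - s) *\<^sub>R snd v)"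
      using norm_triangle_sub[of "snd (\<gamma> y) - snd (\<gamma> s)" "(y - s) *\<^sub>R snd v"] by linarith
    then have \<delta>: "norm (snd (\<gamma> y) - snd (\<gamma> s)) \<le> a * \<bar>y - s\<bar>"
      by (simp add: a_def distrib_right mult.commute[of "\<bar>y - s\<bar>"])
    let ?\<delta> = "norm (snd (\<gamma> y) - snd (\<gamma> s))"
    define \<theta> where "\<theta> = arccos (snd (\<gamma> s) \<bullet> snd (\<gamma> y))"
    have u: "snd (\<gamma> s) \<bullet> snd (\<gamma> s) = 1" "snd (\<gamma> y) \<bullet> snd (\<gamma> y) = 1"
      using \<gamma> by (auto simp: einstein_iff)
    have \<theta>: "0 \<le> \<theta>" "\<theta> \<le> pi" "cos \<theta> = snd (\<gamma> s) \<bullet> snd (\<gamma> y)"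
      using unit_arccos_bounds[OF u] by (auto simp: \<theta>_def)
    \<comment> \<open>Half-angle formula: an arc \<theta> on the unit sphere has chord
      \<open>2 * sin (\<theta> / 2)\<close>.\<close>
    have "?\<delta>\<^sup>2 = 2 - 2 * cos \<theta>"
      using u by (simp add: \<theta>(3) power2_norm_eq_inner inner_diff inner_commute)
    also have "\<dots> = (2 * sin (\<theta> / 2))\<^sup>2"
      using cos_double_sin[of "\<theta> / 2"] by (simp add: power_mult_distrib)
    finally have "?\<delta> = 2 * sin (\<theta> / 2)"
      by (rule power2_eq_imp_eq) (use \<theta> in \<open>simp_all add: sin_ge_zero\<close>)
    then have \<theta>\<delta>: "\<theta> / 2 = arcsin (?\<delta> / 2)" using \<theta> by (simp add: arcsin_sin)
    show "arccos (snd (\<gamma> s) \<bullet> snd (\<gamma> y)) < b * \<bar>y - s\<bar>"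
    proof (cases "?\<delta> = 0")
      case True
      then show ?thesis using \<theta>\<delta> ab y by (simp add: \<theta>_def)
    next
      case False
      have "?\<delta> / 2 < d2"
        using \<delta> y(3) ab norm_ge_zero[of "snd (\<gamma> y) - snd (\<gamma> s)"] d2(1)
        unfolding pos_less_divide_eq[OF ab(1)] mult.commute[of "\<bar>y - s\<bar>"] by linarith
      then have "\<theta> / 2 < (b / a) * (?\<delta> / 2)" using d2(2)[of "?\<delta> / 2"] False \<theta>\<delta> by simp
      then have "\<theta> < (b / a) * ?\<delta>" by simp
      also have "\<dots> \<le> (b / a) * (a * \<bar>y - s\<bar>)" using \<delta> ab by (intro mult_left_mono) auto
      finally show ?thesis using ab by (simp add: \<theta>_def)
    qed
  qed
  show ?thesis
  proof (rule that[of "min d1 (d2 / a)"])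
    show "min d1 (d2 / a) > 0" using d1 d2 ab by simp
    fix h :: real assume h: "0 < h" "h < min d1 (d2 / a)"
    show "chron (\<gamma> s) (\<gamma> (s + h)) \<and> chron (\<gamma> (s - h)) (\<gamma> s)"
      using main[of "s + h"] main[of "s - h"] h
      by (auto simp: chron_def b_def algebra_simps inner_commute)
  qed
qed

lemma chron_on_curve:
  fixes \<gamma> :: "real \<Rightarrow> real \<times> 'a::euclidean_space"
  assumes \<gamma>: "\<And>s. \<gamma> s \<in> einstein" and der: "\<And>s. (\<gamma> has_vector_derivative \<gamma>' s) (at s)"
    and v: "\<And>s. norm (snd (\<gamma>' s)) < fst (\<gamma>' s)" and "a < b" and dim: "2 \<le> DIM('a)"
  shows "chron (\<gamma> a) (\<gamma> b)"
proof -
  \<comment> \<open>\<open>Bolzano\<close> also meets intervals of length zero, where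
    \<open>chron\<close> fails because it is irreflexive; hence the guard
    \<open>a < b\<close>.\<close>
  define P where "P a b \<longleftrightarrow> (a < b \<longrightarrow> chron (\<gamma> a) (\<gamma> b))" for a b
  have "P a b" using less_imp_le[OF \<open>a < b\<close>]
  proof (induction rule: Bolzano)
    case (trans a b c)
    then show ?case
      using chron_trans[of "\<gamma> a" "\<gamma> b" "\<gamma> c"] \<gamma> dim unfolding P_def
      by (cases "a = b"; cases "b = c") auto
  next
    case (local x)
    obtain d where d: "d > 0"
      "\<And>h. 0 < h \<Longrightarrow> h < d \<Longrightarrow> chron (\<gamma> x) (\<gamma> (x + h)) \<and> chron (\<gamma> (x - h)) (\<gamma> x)"
      using chron_local_on_curve[OF \<gamma> der v] by blast
    have "P a b" if "a \<le> x" "x \<le> b" "b - a < d" for a b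
    proof -
      have "a < x \<Longrightarrow> chron (\<gamma> a) (\<gamma> x)" "x < b \<Longrightarrow> chron (\<gamma> x) (\<gamma> b)"
        using d(2)[of "x - a"] d(2)[of "b - x"] that by auto
      then show ?thesis
        using chron_trans[of "\<gamma> a" "\<gamma> x" "\<gamma> b"] \<gamma> dim that unfolding P_def
        by (cases "a = x"; cases "x = b") auto
    qed
    then show ?case using d(1) by blast
  qed
  then show ?thesis using \<open>a < b\<close> by (simp add: P_def)
qed

text \<open>The Darboux property, for a derivative that may be discontinuous: \<open>f\<close> rises
  at \<open>a\<close> and falls at \<open>b\<close>, so its maximum on the interval is interior and
  the derivative vanishes there.\<close>

lemma derivative_sign_change_zero:
  fixes f f' :: "real \<Rightarrow> real"
  assumes der: "\<And>s. (f has_real_derivative f' s) (at s)" and "a < b" "f' a > 0" "f' b < 0"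
  shows "\<exists>c. f' c = 0"
proof -
  have "continuous_on {a..b} f" using der by (meson DERIV_isCont continuous_at_imp_continuous_on)
  then obtain c where c: "c \<in> {a..b}" "\<And>y. y \<in> {a..b} \<Longrightarrow> f y \<le> f c"
    using continuous_attains_sup[of "{a..b}" f] \<open>a < b\<close> by auto
  have "c \<noteq> a"
  proof
    assume "c = a"
    obtain d where d: "d > 0" "\<And>h. h > 0 \<Longrightarrow> h < d \<Longrightarrow> f a < f (a + h)"
      using DERIV_pos_inc_right[OF der \<open>f' a > 0\<close>] by blast
    obtain h where "0 < h" "h < min d (b - a)"
      using dense[of 0 "min d (b - a)"] d(1) \<open>a < b\<close> by auto
    then show False using c(2)[of "a + h"] d(2)[of h] \<open>c = a\<close> by auto
  qed
  moreover have "c \<noteq> b"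
  proof
    assume "c = b"
    obtain d where d: "d > 0" "\<And>h. h > 0 \<Longrightarrow> h < d \<Longrightarrow> f b < f (b - h)"
      using DERIV_neg_dec_left[OF der \<open>f' b < 0\<close>] by blast
    obtain h where "0 < h" "h < min d (b - a)"
      using dense[of 0 "min d (b - a)"] d(1) \<open>a < b\<close> by auto
    then show False using c(2)[of "b - h"] d(2)[of h] \<open>c = b\<close> by auto
  qed
  ultimately have "a < c" "c < b" using c by auto
  have "f' c = 0"
    by (rule DERIV_local_max[OF der, of "min (c - a) (b - c)"])
      (use \<open>a < c\<close> \<open>c < b\<close> in \<open>auto intro!: c(2)\<close>)
  then show ?thesis by blast
qed

lemma nonvanishing_derivative_sign:
  fixes f f' :: "real \<Rightarrow> real"
  assumes der: "\<And>s. (f has_real_derivative f' s) (at s)" and nz: "\<And>s. f' s \<noteq> 0"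
  shows "(\<forall>s. f' s > 0) \<or> (\<forall>s. f' s < 0)"
proof (rule ccontr)
  assume "\<not> ?thesis"
  then obtain a b where ab: "f' a > 0" "f' b < 0" using nz by (meson linorder_neqE)
  have "((\<lambda>s. - f s) has_real_derivative - f' s) (at s)" for s
    by (intro derivative_intros der)
  with ab show False
    using derivative_sign_change_zero[of f f' a b, OF der]
      derivative_sign_change_zero[of "\<lambda>s. - f s" "\<lambda>s. - f' s" b a] nz
    by (cases a b rule: linorder_cases) auto
qed

definition timelike :: "real \<times> 'a::euclidean_space \<Rightarrow> bool" where
  "timelike v \<longleftrightarrow> lorentz_form v v < 0"

lemma timelike_iff: "timelike v \<longleftrightarrow> norm (snd v) < \<bar>fst v\<bar>"
  unfolding timelike_def lorentz_form_def
  by (simp add: dot_square_norm flip: power2_eq_square) (metis abs_norm_cancel linorder_not_le abs_le_square_iff)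

text \<open>The velocity is asked for pointwise and may have either time direction, because this is
  what \<open>lift_along_curve\<close> delivers; the whole real line as domain avoids one-sided
  derivatives.\<close>

definition timelike_curve :: "(real \<Rightarrow> real \<times> 'a::euclidean_space) \<Rightarrow> bool" where
  "timelike_curve \<gamma> \<longleftrightarrow> range \<gamma> \<subseteq> einstein \<and>
     (\<forall>s. \<exists>v. (\<gamma> has_vector_derivative v) (at s) \<and> timelike v)"

lemma timelike_curve_chron:
  fixes \<gamma> :: "real \<Rightarrow> real \<times> 'a::euclidean_space"
  assumes "timelike_curve \<gamma>" and dim: "2 \<le> DIM('a)"
  shows "chron (\<gamma> 0) (\<gamma> 1) \<or> chron (\<gamma> 1) (\<gamma> 0)"
proof -
  obtain \<gamma>' where \<gamma>: "\<And>s. \<gamma> s \<in> einstein" and der: "\<And>s. (\<gamma> has_vector_derivative \<gamma>' s) (at s)"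
    and tl: "\<And>s. norm (snd (\<gamma>' s)) < \<bar>fst (\<gamma>' s)\<bar>"
    using assms(1) unfolding timelike_curve_def timelike_iff by (metis rangeI subsetD)
  have "((\<lambda>s. fst (\<gamma> s)) has_real_derivative fst (\<gamma>' s)) (at s)" for s
    using has_derivative_fst[OF der[of s, unfolded has_vector_derivative_def]]
    by (simp add: has_field_derivative_def mult.commute[of "fst (\<gamma>' s)"] mult_commute_abs)
  moreover have "fst (\<gamma>' s) \<noteq> 0" for s using tl[of s] norm_ge_zero[of "snd (\<gamma>' s)"] by linarith
  ultimately consider "\<forall>s. fst (\<gamma>' s) > 0" | "\<forall>s. fst (\<gamma>' s) < 0"
    using nonvanishing_derivative_sign[of "\<lambda>s. fst (\<gamma> s)" "\<lambda>s. fst (\<gamma>' s)"] by blast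
  then show ?thesis
  proof cases
    case 1
    then have "norm (snd (\<gamma>' s)) < fst (\<gamma>' s)" for s using tl[of s] by (simp add: abs_of_pos)
    then show ?thesis using chron_on_curve[OF \<gamma> der _ _ dim, of 0 1] by simp
  next
    case 2
    \<comment> \<open>The curve run backwards, on parameters from \<open>- 1\<close> to 0, has
      future-directed velocity.\<close>
    have "chron (\<gamma> (- (- 1))) (\<gamma> (- 0))"
    proof (rule chron_on_curve[of "\<lambda>s. \<gamma> (- s)" "\<lambda>s. - \<gamma>' (- s)", OF _ _ _ _ dim])
      fix s
      show "((\<lambda>s. \<gamma> (- s)) has_vector_derivative - \<gamma>' (- s)) (at s)"
        using vector_diff_chain_at[of uminus "-1" s \<gamma> "\<gamma>' (- s)"] der
        by (simp add: o_def has_vector_derivative_minus[OF has_vector_derivative_id, simplified])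
      show "norm (snd (- \<gamma>' (- s))) < fst (- \<gamma>' (- s))"
        using tl[of "- s"] 2 by (simp add: abs_of_neg)
    qed (use \<gamma> in auto)
    then show ?thesis by simp
  qed
qed

text \<open>Follow the great circle from \<open>snd x\<close> to \<open>snd y\<close> with constant
  angular speed \<open>d\<close> while time passes at rate \<open>t\<close>;
  \<open>chron x y\<close> is precisely \<open>d < t\<close>.\<close>

lemma chron_timelike_curve:
  fixes x y :: "real \<times> 'a::euclidean_space"
  assumes "x \<in> einstein" "y \<in> einstein" "chron x y" "2 \<le> DIM('a)"
  obtains \<gamma> where "timelike_curve \<gamma>" "\<gamma> 0 = x" "\<gamma> 1 = y"
proof -
  have u: "snd x \<bullet> snd x = 1" "snd y \<bullet> snd y = 1" using assms by (auto simp: einstein_iff)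
  define d where "d = arccos (snd x \<bullet> snd y)"
  define t where "t = fst y - fst x"
  have d: "0 \<le> d" "d < t" using assms unit_arccos_bounds[OF u] by (auto simp: d_def t_def chron_def)
  obtain e where e: "e \<bullet> e = 1" "snd x \<bullet> e = 0" "snd y = cos d *\<^sub>R snd x + sin d *\<^sub>R e"
    using unit_vector_decomposition[OF u assms(4)] unfolding d_def by metis
  define \<gamma> where "\<gamma> s = (fst x + s * t, cos (s * d) *\<^sub>R snd x + sin (s * d) *\<^sub>R e)" for s
  have "\<gamma> s \<in> einstein" for s
    using u e by (simp add: \<gamma>_def einstein_iff inner_add inner_commute flip: power2_eq_square)
  moreover have "(\<gamma> has_vector_derivative (t, (- (sin (s * d) * d)) *\<^sub>R snd x + (cos (s * d) * d) *\<^sub>R e)) (at s)" for s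
    unfolding \<gamma>_def
    by (rule has_vector_derivative_Pair; (rule derivative_eq_intros | simp add: mult.commute)+)
  moreover have "timelike (t, (- (sin (s * d) * d)) *\<^sub>R snd x + (cos (s * d) * d) *\<^sub>R e)" for s
  proof -
    have "((- (sin (s * d) * d)) *\<^sub>R snd x + (cos (s * d) * d) *\<^sub>R e) \<bullet>
      ((- (sin (s * d) * d)) *\<^sub>R snd x + (cos (s * d) * d) *\<^sub>R e) = d\<^sup>2 * ((sin (s * d))\<^sup>2 + (cos (s * d))\<^sup>2)"
      using u e by (simp add: inner_add inner_diff inner_commute power2_eq_square distrib_left mult_ac)
    then show ?thesis using d
      by (simp add: timelike_def lorentz_form_def power_strict_mono flip: power2_eq_square)
  qed
  ultimately have "timelike_curve \<gamma>" unfolding timelike_curve_def by blast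
  moreover have "\<gamma> 0 = x" "\<gamma> 1 = y" using e by (auto simp: \<gamma>_def t_def prod_eq_iff)
  ultimately show ?thesis by (rule that)
qed

section \<open>Functions of class \<open>C\<^sup>k\<close>\<close>

lemma ck_on_cong:
  assumes "ck_on k S f" "open S" "\<And>x. x \<in> S \<Longrightarrow> f x = g x"
  shows "ck_on k S g"
  using assms(1,3)
proof (induction k arbitrary: f g)
  case 0
  then show ?case using continuous_on_cong[of S S f g] by simp
next
  case (Suc k)
  have der: "(g has_derivative frechet_derivative f (at x)) (at x)" if "x \<in> S" for x
    using Suc.prems \<open>open S\<close> that
    by (intro has_derivative_transform_within_open[of f _ x UNIV S g])
       (auto simp: frechet_derivative_works[symmetric])
  then have "frechet_derivative f (at x) = frechet_derivative g (at x)" if "x \<in> S" for x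
    using frechet_derivative_at that by blast
  then have "ck_on k S (\<lambda>x. frechet_derivative g (at x) v)" for v
    using Suc.IH[of "\<lambda>x. frechet_derivative f (at x) v"] Suc.prems(1) by simp
  then show ?case using der by (auto simp: differentiable_def)
qed

lemma ck_on_Suc_derivI:
  assumes "\<And>x. x \<in> S \<Longrightarrow> (f has_derivative D x) (at x)" "open S" "\<And>v. ck_on k S (\<lambda>x. D x v)"
  shows "ck_on (Suc k) S f"
proof -
  have "D x = frechet_derivative f (at x)" if "x \<in> S" for x
    using assms(1)[OF that] frechet_derivative_at by blast
  then show ?thesis
    using assms(1) by (auto simp: differentiable_def intro!: ck_on_cong[OF assms(3,2)])
qed

lemma ck_on_SucD:
  assumes "ck_on (Suc k) S f"
  shows "x \<in> S \<Longrightarrow> (f has_derivative frechet_derivative f (at x)) (at x)"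
    and "ck_on k S (\<lambda>x. frechet_derivative f (at x) v)"
  using assms by (auto simp: frechet_derivative_works[symmetric])

lemma ck_on_Suc_imp: "ck_on (Suc k) S f \<Longrightarrow> ck_on k S f"
proof (induction k arbitrary: f)
  case 0
  then show ?case by (auto intro!: continuous_at_imp_continuous_on differentiable_imp_continuous_within)
next
  case (Suc k)
  show ?case
    using Suc.prems Suc.IH by (subst ck_on.simps) (metis ck_on.simps(2))
qed

lemma ck_on_const: "open S \<Longrightarrow> ck_on k S (\<lambda>x. c)"
proof (induction k arbitrary: c)
  case (Suc k)
  show ?case
    by (rule ck_on_Suc_derivI[where D = "\<lambda>x v. 0"]) (use Suc in auto)
qed simp

lemma ck_on_bounded_linear:
  assumes "bounded_linear f" "open S"
  shows "ck_on k S f"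
proof (cases k)
  case 0
  then show ?thesis using assms by (simp add: linear_continuous_on)
next
  case (Suc j)
  show ?thesis unfolding Suc
    by (rule ck_on_Suc_derivI[where D = "\<lambda>x. f"])
       (use assms in \<open>auto intro: ck_on_const bounded_linear_imp_has_derivative\<close>)
qed

lemma ck_on_add:
  assumes "ck_on k S f" "ck_on k S g" "open S"
  shows "ck_on k S (\<lambda>x. f x + g x)"
  using assms(1,2)
proof (induction k arbitrary: f g)
  case 0
  then show ?case by (simp add: continuous_on_add)
next
  case (Suc k)
  note d = ck_on_SucD[OF Suc.prems(1)] ck_on_SucD[OF Suc.prems(2)]
  show ?case
    by (rule ck_on_Suc_derivI[where
          D = "\<lambda>x v. frechet_derivative f (at x) v + frechet_derivative g (at x) v"])
       (use d Suc.IH \<open>open S\<close> in \<open>auto intro!: has_derivative_add\<close>)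
qed

lemma ck_on_scaleR:
  fixes f :: "'a::euclidean_space \<Rightarrow> real" and g :: "'a \<Rightarrow> 'b::euclidean_space"
  assumes "ck_on k S f" "ck_on k S g" "open S"
  shows "ck_on k S (\<lambda>x. f x *\<^sub>R g x)"
  using assms(1,2)
proof (induction k arbitrary: f g)
  case 0
  then show ?case by (simp add: continuous_on_scaleR)
next
  case (Suc k)
  note d = ck_on_SucD[OF Suc.prems(1)] ck_on_SucD[OF Suc.prems(2)]
  \<comment> \<open>Each term of the product rule leaves one factor undifferentiated, so the
    induction hypothesis is also applied to \<open>f\<close> and \<open>g\<close>
    themselves.\<close>
  have lower: "ck_on k S f" "ck_on k S g" using Suc.prems ck_on_Suc_imp by blast+
  show ?case
    by (rule ck_on_Suc_derivI[where
          D = "\<lambda>x v. f x *\<^sub>R frechet_derivative g (at x) v + frechet_derivative f (at x) v *\<^sub>R g x"])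
       (use d lower Suc.IH \<open>open S\<close> in \<open>auto intro!: has_derivative_scaleR ck_on_add\<close>)
qed

lemma ck_on_Pair:
  assumes "ck_on k S f" "ck_on k S g" "open S"
  shows "ck_on k S (\<lambda>x. (f x, g x))"
  using assms(1,2)
proof (induction k arbitrary: f g)
  case 0
  then show ?case by (simp add: continuous_on_Pair)
next
  case (Suc k)
  note d = ck_on_SucD[OF Suc.prems(1)] ck_on_SucD[OF Suc.prems(2)]
  show ?case
    by (rule ck_on_Suc_derivI[where
          D = "\<lambda>x v. (frechet_derivative f (at x) v, frechet_derivative g (at x) v)"])
       (use d Suc.IH \<open>open S\<close> in \<open>auto intro!: has_derivative_Pair\<close>)
qed

section \<open>Polar coordinates\<close>

text \<open>Polar coordinates identify \<open>einstein\<close> with the punctured model space by a single chart.\<close>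

definition polar :: "'a::euclidean_space \<Rightarrow> real \<times> 'a" where
  "polar z = (ln (norm z), z /\<^sub>R norm z)"

definition cart :: "real \<times> 'a::euclidean_space \<Rightarrow> 'a" where
  "cart x = exp (fst x) *\<^sub>R snd x"

lemma polar_einstein: "z \<noteq> 0 \<Longrightarrow> polar z \<in> einstein"
  by (simp add: polar_def einstein_iff dot_square_norm power2_eq_square field_simps)

lemma cart_polar [simp]: "z \<noteq> 0 \<Longrightarrow> cart (polar z) = z"
  by (simp add: polar_def cart_def)

lemma norm_cart: "x \<in> einstein \<Longrightarrow> norm (cart x) = exp (fst x)"
  by (simp add: cart_def norm_snd_einstein)

lemma cart_nonzero: "x \<in> einstein \<Longrightarrow> cart x \<noteq> 0"
  by (metis norm_cart norm_zero exp_not_eq_zero)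

lemma polar_cart [simp]: "x \<in> einstein \<Longrightarrow> polar (cart x) = x"
  by (simp add: polar_def norm_cart prod_eq_iff) (simp add: cart_def)

text \<open>The exponent must vary in the induction: differentiating yields a linear factor times
  the same function with exponent \<open>p - 1\<close>. The cases used later are
  \<open>- 1 / 2\<close>, the normalisation in \<open>polar\<close>, and \<open>- 1\<close>, from
  the derivative of \<open>ln (norm z)\<close>.\<close>

lemma ck_on_norm_powr:
  "ck_on k (- {0}) (\<lambda>z::'a::euclidean_space. (z \<bullet> z) powr p)"
proof (induction k arbitrary: p)
  case 0
  show ?case by (auto intro!: continuous_intros)
next
  case (Suc k)
  show ?case
  proof (rule ck_on_Suc_derivI[where D = "\<lambda>z v. (2 * p * (v \<bullet> z)) *\<^sub>R (z \<bullet> z) powr (p - 1)"])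
    fix z :: 'a assume "z \<in> - {0}"
    then show "((\<lambda>z. (z \<bullet> z) powr p) has_derivative
        (\<lambda>v. (2 * p * (v \<bullet> z)) *\<^sub>R (z \<bullet> z) powr (p - 1))) (at z)"
      by (auto intro!: derivative_eq_intros simp: fun_eq_iff inner_commute powr_diff field_simps)
  next
    fix v :: 'a
    have "bounded_linear (\<lambda>z. 2 * p * (v \<bullet> z))"
      by (intro bounded_linear_intros)
    then show "ck_on k (- {0}) (\<lambda>z. (2 * p * (v \<bullet> z)) *\<^sub>R (z \<bullet> z) powr (p - 1))"
      by (intro ck_on_scaleR ck_on_bounded_linear Suc.IH) auto
  qed auto
qed

lemma ck_on_ln_norm: "ck_on k (- {0}) (\<lambda>z::'a::euclidean_space. ln (norm z))"
proof (cases k)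
  case 0
  then show ?thesis by (auto intro!: continuous_intros)
next
  case (Suc j)
  show ?thesis unfolding Suc
  proof (rule ck_on_Suc_derivI[where D = "\<lambda>z v. (v \<bullet> z) *\<^sub>R (z \<bullet> z) powr - 1"])
    fix z :: 'a assume "z \<in> - {0}"
    then show "((\<lambda>z. ln (norm z)) has_derivative (\<lambda>v. (v \<bullet> z) *\<^sub>R (z \<bullet> z) powr - 1)) (at z)"
      by (auto intro!: derivative_eq_intros has_derivative_norm
          simp: fun_eq_iff sgn_div_norm dot_square_norm powr_minus power2_eq_square field_simps)
  next
    fix v :: 'a
    show "ck_on j (- {0}) (\<lambda>z. (v \<bullet> z) *\<^sub>R (z \<bullet> z) powr - 1)"
      by (intro ck_on_scaleR ck_on_bounded_linear ck_on_norm_powr bounded_linear_inner_right) auto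
  qed auto
qed

lemma ck_on_polar: "ck_on k (- {0}) polar"
proof -
  have "ck_on k (- {0}) (\<lambda>z::'a. (ln (norm z), (z \<bullet> z) powr (- 1 / 2) *\<^sub>R z))"
    by (intro ck_on_Pair ck_on_ln_norm ck_on_scaleR ck_on_norm_powr ck_on_bounded_linear
        bounded_linear_ident) auto
  then show ?thesis
    by (rule ck_on_cong)
       (auto simp: polar_def norm_eq_sqrt_inner powr_minus powr_half_sqrt)
qed

lemma ck_on_cart: "ck_on k UNIV (cart :: real \<times> 'a::euclidean_space \<Rightarrow> 'a)"
proof -
  \<comment> \<open>Directional derivatives of \<open>cart\<close> are no longer multiples of
    \<open>cart\<close>, but these products with an affine function of \<open>snd x\<close> form a
    closed family: the new coefficients are \<open>fst v * a\<close> and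
    \<open>fst v *\<^sub>R w + a *\<^sub>R snd v\<close>.\<close>
  have "ck_on k UNIV (\<lambda>x :: real \<times> 'a. exp (fst x) *\<^sub>R (a *\<^sub>R snd x + w))" for a w
  proof (induction k arbitrary: a w)
    case 0
    show ?case by (auto intro!: continuous_intros)
  next
    case (Suc k)
    show ?case
    proof (rule ck_on_Suc_derivI[where
          D = "\<lambda>x v. exp (fst x) *\<^sub>R ((fst v * a) *\<^sub>R snd x + (fst v *\<^sub>R w + a *\<^sub>R snd v))"])
      fix x :: "real \<times> 'a"
      show "((\<lambda>x. exp (fst x) *\<^sub>R (a *\<^sub>R snd x + w)) has_derivative
        (\<lambda>v. exp (fst x) *\<^sub>R ((fst v * a) *\<^sub>R snd x + (fst v *\<^sub>R w + a *\<^sub>R snd v)))) (at x)"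
        by (auto intro!: derivative_eq_intros simp: fun_eq_iff algebra_simps)
    qed (use Suc.IH in auto)
  qed
  from this[of 1 0] show ?thesis by (simp add: cart_def[abs_def])
qed

lemma polar_has_derivative:
  "z \<noteq> 0 \<Longrightarrow> (polar has_derivative frechet_derivative polar (at z)) (at z)"
  using ck_on_SucD(1)[OF ck_on_polar[of "Suc 0"]] by auto

lemma cart_has_derivative: "(cart has_derivative frechet_derivative cart (at x)) (at x)"
  using ck_on_SucD(1)[OF ck_on_cart[of "Suc 0"]] by simp

lemma continuous_on_polar: "continuous_on (- {0}) polar"
  using ck_on_polar[of 0] by simp

lemma continuous_on_cart: "continuous_on S cart"
  using ck_on_cart[of 0] continuous_on_subset by auto

lemma smooth_on_differentiable:
  assumes "smooth_on S f" "open S" "x \<in> S"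
  shows "f differentiable (at x)"
proof -
  obtain V F where V: "open V" "x \<in> V" "\<And>k. ck_on k V F" "\<And>z. z \<in> S \<inter> V \<Longrightarrow> F z = f z"
    using assms unfolding smooth_on_def by metis
  have "(F has_derivative frechet_derivative F (at x)) (at x)"
    using ck_on_SucD(1)[OF V(3)[of "Suc 0"] V(2)] .
  then have "(f has_derivative frechet_derivative F (at x)) (at x)"
    by (rule has_derivative_transform_within_open[of _ _ _ _ "S \<inter> V"]) (use V assms in auto)
  then show ?thesis by (auto simp: differentiable_def)
qed

text \<open>Under \<open>polar\<close> this becomes a slab of \<open>einstein\<close> of time length
  \<open>pi\<close> centred at \<open>a\<close>. A nonzero power of \<open>sig\<close> shifts time
  by at least \<open>pi\<close>, so an orbit meets the open slab at most once, and every point has a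
  slab centred at its own time.\<close>

definition annulus :: "real \<Rightarrow> 'a::euclidean_space set" where
  "annulus a = {z. z \<noteq> 0 \<and> a - pi / 2 < ln (norm z) \<and> ln (norm z) < a + pi / 2}"

lemma annulus_subset: "annulus a \<subseteq> - {0}"
  by (auto simp: annulus_def)

lemma open_annulus: "open (annulus a)"
proof -
  have "open ((- {0}) \<inter> (\<lambda>z::'a. ln (norm z)) -` {a - pi / 2 <..< a + pi / 2})"
    by (intro continuous_open_preimage continuous_intros) auto
  also have "(- {0}) \<inter> (\<lambda>z::'a. ln (norm z)) -` {a - pi / 2 <..< a + pi / 2} = annulus a"
    by (auto simp: annulus_def)
  finally show ?thesis .
qed

lemma cart_annulus: "x \<in> einstein \<Longrightarrow> cart x \<in> annulus a \<longleftrightarrow> a - pi / 2 < fst x \<and> fst x < a + pi / 2"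
  by (simp add: annulus_def cart_nonzero norm_cart)

lemma polar_annulus: "polar ` annulus a = {x \<in> einstein. a - pi / 2 < fst x \<and> fst x < a + pi / 2}"
proof (intro equalityI subsetI)
  fix x assume "x \<in> polar ` annulus a"
  then show "x \<in> {x \<in> einstein. a - pi / 2 < fst x \<and> fst x < a + pi / 2}"
    by (auto simp: polar_einstein annulus_def) (simp_all add: polar_def)
next
  fix x :: "real \<times> 'a" assume "x \<in> {x \<in> einstein. a - pi / 2 < fst x \<and> fst x < a + pi / 2}"
  then show "x \<in> polar ` annulus a"
    by (intro image_eqI[of _ _ "cart x"]) (auto simp: cart_annulus)
qed

definition polar_chart :: "real \<Rightarrow> ('a::euclidean_space, real \<times> 'a) metric_chart" where
  "polar_chart a = \<lparr>coord_dom = annulus a, param = polar,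
     metric_coeff = (\<lambda>x v w. lorentz_form (frechet_derivative polar (at x) v)
                                          (frechet_derivative polar (at x) w))\<rparr>"

lemma polar_chart_in_atlas: "polar_chart a \<in> (einstein_atlas :: ('a::euclidean_space, _) metric_atlas)"
proof -
  let ?U = "{x \<in> einstein :: (real \<times> 'a) set. a - pi / 2 < fst x \<and> fst x < a + pi / 2}"
  have "?U = einstein \<inter> fst -` {a - pi / 2 <..< a + pi / 2}" by auto
  then have "openin (top_of_set einstein) ?U"
    by (auto simp: openin_open intro!: open_vimage_fst exI[of _ "fst -` {a - pi / 2 <..< a + pi / 2}"])
  moreover have "homeomorphism (annulus a) ?U polar cart"
    unfolding homeomorphism_def
  proof (intro conjI)
    show "polar ` annulus a = ?U" by (rule polar_annulus)
    have "cart ` polar ` annulus a = annulus a"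
      unfolding image_image by (auto simp: annulus_def)
    then show "cart ` ?U = annulus a" by (simp only: polar_annulus)
    show "\<forall>x\<in>annulus a. cart (polar x) = x" by (simp add: annulus_def)
    show "continuous_on (annulus a) polar"
      by (rule continuous_on_subset[OF continuous_on_polar annulus_subset])
  qed (simp_all add: continuous_on_cart)
  moreover have "smooth_on (annulus a) (polar :: 'a \<Rightarrow> _)"
    unfolding smooth_on_def
    using ck_on_polar annulus_subset by (intro ballI exI[of _ "- {0}"] exI[of _ polar]) auto
  moreover have "smooth_on ?U cart"
    unfolding smooth_on_def using ck_on_cart by (intro ballI exI[of _ UNIV] exI[of _ cart]) auto
  ultimately show ?thesis
    unfolding einstein_atlas_def polar_chart_def using open_annulus by blast
qed

section \<open>Quotients by powers of the shift\<close>

lemma bij_betw_sig: "bij_betw (sig j) einstein einstein"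
  by (rule bij_betw_byWitness[where f' = "sig (- j)"]) (auto simp: sig_sig)

lemma restrict_sig_in_BijGroup: "restrict (sig j) einstein \<in> carrier (BijGroup einstein)"
  using bij_betw_sig[of j] by (simp add: BijGroup_def Bij_def bij_betw_restrict_eq)

lemma restrict_sig_mult:
  "restrict (sig i) einstein \<otimes>\<^bsub>BijGroup einstein\<^esub> restrict (sig j) einstein = restrict (sig (i + j)) einstein"
  using restrict_sig_in_BijGroup[of i] restrict_sig_in_BijGroup[of j]
  by (auto simp: BijGroup_def compose_def sig_sig fun_eq_iff)

lemma restrict_sig_one: "\<one>\<^bsub>BijGroup einstein\<^esub> = restrict (sig 0) einstein"
  by (auto simp: BijGroup_def fun_eq_iff)

lemma restrict_sig_inv: "inv\<^bsub>BijGroup einstein\<^esub> restrict (sig i) einstein = restrict (sig (- i)) einstein"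
  by (rule group.inv_equality[OF group_BijGroup])
     (simp_all add: restrict_sig_mult restrict_sig_one restrict_sig_in_BijGroup)

lemma restrict_sig_nat_pow:
  "restrict (sig m) einstein [^]\<^bsub>BijGroup einstein\<^esub> (n::nat) = restrict (sig (m * int n)) einstein"
proof (induction n)
  case 0
  show ?case by (simp only: nat_pow_0 restrict_sig_one of_nat_0 mult_zero_right)
next
  case (Suc n)
  then show ?case by (simp only: nat_pow_Suc restrict_sig_mult) (simp add: algebra_simps)
qed

lemma restrict_sig_int_pow:
  "restrict (sig m) einstein [^]\<^bsub>BijGroup einstein\<^esub> (j::int) = restrict (sig (m * j)) einstein"
  by (simp add: int_pow_def2 restrict_sig_nat_pow restrict_sig_inv)

definition proj :: "int \<Rightarrow> real \<times> 'a::euclidean_space \<Rightarrow> (real \<times> 'a) set" where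
  "proj m = orbit (generated_transformation_group (sig m)) (\<lambda>g. g)"

definition sig_quotient :: "int \<Rightarrow> 'a::euclidean_space einstein_quotient" where
  "sig_quotient m = quotient_atlas (generated_transformation_group (sig m)) (\<lambda>g. g) einstein_atlas"

lemma proj_einstein:
  assumes "x \<in> einstein"
  shows "proj m x = range (\<lambda>j. sig (m * j) x)"
proof -
  have "proj m x = {g x | g. g \<in> range (\<lambda>j. restrict (sig (m * j)) einstein)}"
    unfolding proj_def orbit_def generated_transformation_group_def
      group.carrier_subgroup_generated_by_singleton[OF group_BijGroup restrict_sig_in_BijGroup]
      restrict_sig_int_pow ..
  also have "\<dots> = range (\<lambda>j. restrict (sig (m * j)) einstein x)" by blast
  finally show ?thesis using assms by simp
qed

lemma proj_eq_iff:
  assumes "x \<in> einstein" "y \<in> einstein"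
  shows "proj m x = proj m y \<longleftrightarrow> (\<exists>j. y = sig (m * j) x)"
proof
  assume "proj m x = proj m y"
  moreover have "y \<in> proj m y" unfolding proj_einstein[OF assms(2)] by (rule range_eqI[of _ _ 0]) simp
  ultimately have "y \<in> range (\<lambda>j. sig (m * j) x)" by (simp only: proj_einstein[OF assms(1)])
  then show "\<exists>j. y = sig (m * j) x" by blast
next
  assume "\<exists>j. y = sig (m * j) x"
  then obtain j where j: "y = sig (m * j) x" by blast
  have "(\<lambda>i. sig (m * i) y) = (\<lambda>i. sig (m * i) x) \<circ> (\<lambda>i. i + j)"
    by (simp add: fun_eq_iff j sig_sig distrib_left)
  then have "range (\<lambda>i. sig (m * i) y) = (\<lambda>i. sig (m * i) x) ` range (\<lambda>i. i + j)"
    by (simp only: image_comp)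
  also have "\<dots> = range (\<lambda>i. sig (m * i) x)"
    by (simp only: surj_plus_right)
  finally show "proj m x = proj m y"
    by (simp only: proj_einstein[OF assms(1)] proj_einstein[OF assms(2)])
qed

lemma compact_form_I_eq: "compact_form_I k = sig_quotient (2 * int k)"
proof -
  have "(\<lambda>(\<tau>, y). (\<tau> + 2 * real k * pi, y)) = (sig (2 * int k) :: real \<times> 'a \<Rightarrow> _)"
    by (auto simp: sig_def)
  then show ?thesis by (simp add: compact_form_I_def sig_quotient_def)
qed

lemma compact_form_II_eq: "compact_form_II k = sig_quotient (2 * int k + 1)"
proof -
  have "(\<lambda>(\<tau>, y). (\<tau> + (2 * real k + 1) * pi, - y)) = (sig (2 * int k + 1) :: real \<times> 'a \<Rightarrow> _)"
    by (auto simp: sig_def)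
  then show ?thesis by (simp add: compact_form_II_def sig_quotient_def)
qed

section \<open>Charts and points of the quotients\<close>

definition quotient_chart :: "int \<Rightarrow> real \<Rightarrow> ('a::euclidean_space, (real \<times> 'a) set) metric_chart" where
  "quotient_chart m a = \<lparr>coord_dom = annulus a, param = proj m \<circ> polar,
     metric_coeff = metric_coeff (polar_chart a)\<rparr>"

lemma inj_on_proj_polar:
  assumes "m \<ge> 1"
  shows "inj_on (proj m \<circ> polar) (annulus a)"
proof (rule inj_onI)
  fix z w :: 'a assume zw: "z \<in> annulus a" "w \<in> annulus a" "(proj m \<circ> polar) z = (proj m \<circ> polar) w"
  have nz: "z \<noteq> 0" "w \<noteq> 0" using zw(1,2) annulus_subset by blast+
  obtain j where j: "polar w = sig (m * j) (polar z)"
    using zw(3) nz proj_eq_iff[OF polar_einstein polar_einstein, of z w m] by auto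
  have "polar w \<in> polar ` annulus a" "polar z \<in> polar ` annulus a" using zw by auto
  then have "\<bar>fst (polar w) - fst (polar z)\<bar> < pi"
    unfolding polar_annulus by auto
  then have "\<bar>real_of_int (m * j) * pi\<bar> < 1 * pi" by (simp add: j)
  then have "\<bar>real_of_int (m * j)\<bar> < 1" by (simp add: abs_mult)
  then have "\<bar>m * j\<bar> < 1" by linarith
  then have "m * j = 0" by linarith
  then have "polar w = polar z" unfolding j by (simp only: sig_0)
  then show "z = w" using nz by (metis cart_polar)
qed

lemma quotient_chart_in_sig_quotient: "m \<ge> 1 \<Longrightarrow> quotient_chart m a \<in> sig_quotient m"
  unfolding sig_quotient_def quotient_atlas_def quotient_chart_def
  using polar_chart_in_atlas[of a] inj_on_proj_polar[of m a]
  by (intro CollectI exI[of _ "polar_chart a"]) (auto simp: proj_def polar_chart_def)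

lemma einstein_atlas_range:
  assumes "c \<in> einstein_atlas"
  shows "param c ` coord_dom c \<subseteq> einstein"
proof -
  obtain W \<psi> U \<phi> where "coord_dom c = W" "param c = \<psi>" "openin (top_of_set einstein) U"
    "homeomorphism W U \<psi> \<phi>"
    using assms unfolding einstein_atlas_def by fastforce
  then show ?thesis
    using homeomorphism_image1 openin_imp_subset by metis
qed

lemma points_sig_quotient:
  assumes "m \<ge> 1"
  shows "points (sig_quotient m) = proj m ` einstein"
proof (intro equalityI subsetI)
  fix q :: "(real \<times> 'a) set" assume "q \<in> points (sig_quotient m)"
  then obtain c where "c \<in> einstein_atlas" "q \<in> (proj m \<circ> param c) ` coord_dom c"
    unfolding points_def sig_quotient_def quotient_atlas_def proj_def by auto
  then show "q \<in> proj m ` einstein"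
    using einstein_atlas_range[of c] by (metis image_comp image_mono subsetD)
next
  fix q :: "(real \<times> 'a) set" assume "q \<in> proj m ` einstein"
  then obtain x where x: "x \<in> einstein" "q = proj m x" by blast
  then have "q \<in> param (quotient_chart m (fst x)) ` coord_dom (quotient_chart m (fst x))"
    by (intro image_eqI[of _ _ "cart x"]) (auto simp: quotient_chart_def cart_annulus)
  then show "q \<in> points (sig_quotient m)"
    using quotient_chart_in_sig_quotient[OF assms] unfolding points_def by blast
qed

section \<open>Lifting smooth maps\<close>

lemma einstein_eq_Times: "einstein = UNIV \<times> sphere (0::'a::euclidean_space) 1"
  by (auto simp: einstein_def norm_eq_1)

lemma connected_einstein: "2 \<le> DIM('a::euclidean_space) \<Longrightarrow> connected (einstein :: (real \<times> 'a) set)"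
  unfolding einstein_eq_Times by (intro connected_Times connected_UNIV connected_sphere)

lemma simply_connected_einstein:
  "3 \<le> DIM('a::euclidean_space) \<Longrightarrow> simply_connected (einstein :: (real \<times> 'a) set)"
  unfolding einstein_eq_Times
  by (intro simply_connected_Times simply_connected_sphere convex_imp_simply_connected convex_UNIV)

lemma locally_path_connected_einstein: "locally path_connected (einstein :: (real \<times> 'a::euclidean_space) set)"
  unfolding einstein_eq_Times
  by (rule locally_Times[OF locally_path_connected_UNIV locally_path_connected_sphere])
     (auto intro: path_connected_Times)

text \<open>The set is a continuous image of a product of connected sets: \<open>r\<close> is the
  excess of elapsed time over spherical distance, which ranges over all positive reals independently
  of \<open>p\<close> and \<open>y\<close>.\<close>

lemma connected_chron:
  assumes "2 \<le> DIM('a::euclidean_space)"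
  shows "connected {(p, q). p \<in> einstein \<and> q \<in> einstein \<and> chron p (q :: real \<times> 'a)}"
proof -
  define h :: "(real \<times> 'a) \<times> ('a \<times> real) \<Rightarrow> (real \<times> 'a) \<times> (real \<times> 'a)" where
    "h = (\<lambda>(p, y, r). (p, (fst p + arccos (snd p \<bullet> y) + r, y)))"
  let ?S = "(einstein :: (real \<times> 'a) set) \<times> (sphere (0::'a) 1 \<times> {0::real<..})"
  have "continuous_on ?S h"
    unfolding h_def case_prod_beta
    using unit_inner_bounds by (intro continuous_intros) (auto simp: einstein_iff norm_eq_1)
  moreover have "connected ?S"
    using assms by (intro connected_Times connected_einstein connected_sphere) auto
  ultimately have "connected (h ` ?S)" by (rule connected_continuous_image)
  also have "h ` ?S = {(p, q). p \<in> einstein \<and> q \<in> einstein \<and> chron p q}"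
  proof (intro equalityI subsetI)
    fix w assume "w \<in> {(p, q). p \<in> einstein \<and> q \<in> einstein \<and> chron p (q :: real \<times> 'a)}"
    then obtain p q where "w = (p, q)" "p \<in> einstein" "q \<in> einstein" "chron p q" by blast
    then show "w \<in> h ` ?S"
      by (intro image_eqI[of _ _ "(p, (snd q, fst q - fst p - arccos (snd p \<bullet> snd q)))"])
         (auto simp: h_def chron_def einstein_iff norm_eq_1)
  qed (auto simp: h_def chron_def einstein_iff norm_eq_1)
  finally show ?thesis .
qed

text \<open>The sign of the time difference \<phi> decides which alternative of \<open>pres\<close>
  holds. Since \<phi> is continuous and nonzero on the connected set of related pairs, it has one
  sign there.\<close>

lemma chron_uniform_orientation:
  fixes F :: "real \<times> 'a::euclidean_space \<Rightarrow> real \<times> 'a"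
  assumes cont: "continuous_on einstein F" and F: "F ` einstein \<subseteq> einstein"
    and pres: "\<And>p q. p \<in> einstein \<Longrightarrow> q \<in> einstein \<Longrightarrow> chron p q \<Longrightarrow> chron (F p) (F q) \<or> chron (F q) (F p)"
    and dim: "2 \<le> DIM('a)"
  shows "(\<forall>p\<in>einstein. \<forall>q\<in>einstein. chron p q \<longrightarrow> chron (F p) (F q)) \<or>
         (\<forall>p\<in>einstein. \<forall>q\<in>einstein. chron p q \<longrightarrow> chron (F q) (F p))"
proof -
  let ?S = "{(p, q). p \<in> einstein \<and> q \<in> einstein \<and> chron p (q :: real \<times> 'a)}"
  define \<phi> where "\<phi> = (\<lambda>z. fst (F (snd z)) - fst (F (fst z)))"
  have "continuous_on ?S \<phi>"
    unfolding \<phi>_def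
    by (intro continuous_intros continuous_on_compose2[OF cont]) auto
  then have conn: "connected (\<phi> ` ?S)" using connected_chron[OF dim] by (rule connected_continuous_image)
  have Fe: "F p \<in> einstein" if "p \<in> einstein" for p using that F by blast
  have pos: "\<phi> (p, q) > 0" if "p \<in> einstein" "q \<in> einstein" "chron (F p) (F q)" for p q
    using chron_imp_less[OF that(3) Fe Fe] that by (simp add: \<phi>_def)
  have neg: "\<phi> (p, q) < 0" if "p \<in> einstein" "q \<in> einstein" "chron (F q) (F p)" for p q
    using chron_imp_less[OF that(3) Fe Fe] that by (simp add: \<phi>_def)
  have nz: "\<phi> z \<noteq> 0" if "z \<in> ?S" for z
  proof -
    obtain p q where "z = (p, q)" by (cases z)
    then have z: "z = (p, q)" "p \<in> einstein" "q \<in> einstein" "chron p q" using that by simp_all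
    from pres[OF z(2-4)] show ?thesis using pos[OF z(2,3)] neg[OF z(2,3)] z(1) by fastforce
  qed
  have "chron (F p) (F q)" if "\<phi> (p, q) > 0" "p \<in> einstein" "q \<in> einstein" "chron p q" for p q
    using pres[OF that(2-4)] neg[OF that(2,3)] that(1) by linarith
  moreover have "chron (F q) (F p)" if "\<phi> (p, q) < 0" "p \<in> einstein" "q \<in> einstein" "chron p q" for p q
    using pres[OF that(2-4)] pos[OF that(2,3)] that(1) by linarith
  moreover have "(\<forall>z\<in>?S. \<phi> z > 0) \<or> (\<forall>z\<in>?S. \<phi> z < 0)"
  proof (rule ccontr)
    assume "\<not> ?thesis"
    then obtain z w where "z \<in> ?S" "w \<in> ?S" "\<phi> z \<le> 0" "0 \<le> \<phi> w" by (meson not_less)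
    then have "0 \<in> \<phi> ` ?S" using connectedD_interval[OF conn, of "\<phi> z" "\<phi> w" 0] by blast
    with nz show False by (metis (no_types, lifting) imageE)
  qed
  ultimately show ?thesis by blast
qed

section \<open>Smooth maps between quotients in coordinates\<close>

lemma proj_sig: "x \<in> einstein \<Longrightarrow> proj m (sig (m * j) x) = proj m x"
  using proj_eq_iff[of x "sig (m * j) x" m] by auto

lemma proj_in_points: "m \<ge> 1 \<Longrightarrow> x \<in> einstein \<Longrightarrow> proj m x \<in> points (sig_quotient m)"
  by (simp add: points_sig_quotient)

text \<open>The assumption is smoothness, because the locale serves the map and, with
  \<open>m\<close> and \<open>l\<close> exchanged, its inverse, for which the definition states no
  conformality.\<close>

locale smooth_lift =
  fixes m l :: int and f :: "(real \<times> 'a::euclidean_space) set \<Rightarrow> (real \<times> 'a) set"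
  assumes m: "m \<ge> 1" and l: "l \<ge> 1"
    and f: "smooth_map (sig_quotient m) (sig_quotient l) f"
begin

abbreviation "rep a b \<equiv> coord_rep (quotient_chart m a) (quotient_chart l b) f"

abbreviation "rdom a b \<equiv> rep_dom (quotient_chart m a) (quotient_chart l b) f"

lemma open_dom: "open (rdom a b)" and smooth_rep: "smooth_on (rdom a b) (rep a b)"
  using f quotient_chart_in_sig_quotient[OF m] quotient_chart_in_sig_quotient[OF l]
  unfolding smooth_map_def by blast+

lemma dom_eq: "rdom a b = {z \<in> annulus a. f (proj m (polar z)) \<in> (proj l \<circ> polar) ` annulus b}"
  by (auto simp: rep_dom_def quotient_chart_def)

lemma rep_eq: "rep a b z = inv_into (annulus b) (proj l \<circ> polar) (f (proj m (polar z)))"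
  by (simp add: coord_rep_def quotient_chart_def)

lemma rep_derivative:
  "z \<in> rdom a b \<Longrightarrow> (rep a b has_derivative frechet_derivative (rep a b) (at z)) (at z)"
  using smooth_on_differentiable[OF smooth_rep open_dom] frechet_derivative_works by blast

lemma rep_annulus:
  assumes "z \<in> rdom a b"
  shows "rep a b z \<in> annulus b" "proj l (polar (rep a b z)) = f (proj m (polar z))"
proof -
  have *: "f (proj m (polar z)) \<in> (proj l \<circ> polar) ` annulus b" using assms by (simp add: dom_eq)
  show "rep a b z \<in> annulus b" unfolding rep_eq by (rule inv_into_into[OF *])
  show "proj l (polar (rep a b z)) = f (proj m (polar z))"
    using f_inv_into_f[OF *] unfolding rep_eq comp_def .
qed

lemma f_proj: "x \<in> einstein \<Longrightarrow> f (proj m x) \<in> proj l ` einstein"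
  using f proj_in_points[OF m, of x] points_sig_quotient[OF l] unfolding smooth_map_def by blast

end

text \<open>The map \<open>invariants l\<close> separates the orbits of \<open>sig l\<close>. Its first component takes values in the
  unit circle, so a map into the orbit space is lifted by taking a logarithm of that component.\<close>

definition invariants :: "int \<Rightarrow> real \<times> 'a::euclidean_space \<Rightarrow> complex \<times> 'a \<times> 'a" where
  "invariants l x = (cis (2 * fst x / of_int l), cos (fst x) *\<^sub>R snd x, sin (fst x) *\<^sub>R snd x)"

lemma cos_int_pi: "cos (of_int j * pi) = (if even j then 1 else - 1)"
  by (metis cos_int_times_real cos_npi_int mult.commute)

lemma sin_int_pi: "sin (of_int j * pi) = 0"
  by (metis mult.commute sin_npi_int)

text \<open>Shifting time by \<open>l * j * pi\<close> turns the circle component by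
  \<open>j\<close> full turns and multiplies \<open>cos (fst x)\<close>, \<open>sin (fst x)\<close>
  and \<open>snd x\<close> by the same sign, which cancels in the products.\<close>

lemma invariants_sig:
  assumes "l \<noteq> 0"
  shows "invariants l (sig (l * j) x) = invariants l x"
proof -
  have "cis (2 * (fst x + of_int (l * j) * pi) / of_int l) = cis (2 * fst x / of_int l) * cis (2 * pi * of_int j)"
    using assms by (simp add: cis_mult field_simps)
  moreover have "cis (2 * pi * of_int j) = 1" by (intro cis_multiple_2pi) auto
  moreover have "cos (fst x + of_int (l * j) * pi) = cos (fst x) * cos (of_int (l * j) * pi)"
    "sin (fst x + of_int (l * j) * pi) = sin (fst x) * cos (of_int (l * j) * pi)"
    by (simp_all only: cos_add sin_add sin_int_pi)
  ultimately show ?thesis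
    by (simp add: invariants_def cos_int_pi sig_def del: of_int_mult)
qed

text \<open>A time \<open>t\<close> with the right circle component differs from
  \<open>fst x\<close> by a multiple of \<open>l * pi\<close>. By the addition theorem the
  combination with \<open>cos t\<close> and \<open>sin t\<close> is
  \<open>cos (t - fst x) *\<^sub>R snd x\<close>, that is, \<open>snd x\<close> with the sign that
  \<open>sig\<close> demands. So the sphere coordinate depends continuously on \<open>t\<close> and
  the invariants.\<close>

lemma sig_of_invariants:
  assumes "l \<noteq> 0" "cis (2 * t / of_int l) = fst (invariants l x)"
  shows "\<exists>j. (t, cos t *\<^sub>R fst (snd (invariants l x)) + sin t *\<^sub>R snd (snd (invariants l x))) = sig (l * j) x"
proof -
  have "cis (2 * t / of_int l - 2 * fst x / of_int l) = 1"
    using assms by (simp add: invariants_def cis_divide[symmetric])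
  then have "cos (2 * t / of_int l - 2 * fst x / of_int l) = 1"
    by (simp add: complex_eq_iff)
  then obtain j :: int where "2 * t / of_int l - 2 * fst x / of_int l = of_int j * 2 * pi"
    by (auto simp: cos_one_2pi_int)
  then have t: "t = fst x + of_int (l * j) * pi" using assms by (simp add: field_simps)
  have "cos t *\<^sub>R fst (snd (invariants l x)) + sin t *\<^sub>R snd (snd (invariants l x)) = cos (t - fst x) *\<^sub>R snd x"
    by (simp add: invariants_def cos_diff scaleR_add_left)
  also have "t - fst x = of_int (l * j) * pi" using t by simp
  finally show ?thesis
    by (intro exI[of _ j]) (auto simp: sig_def t cos_int_pi simp del: of_int_mult)
qed

lemma continuous_on_invariants: "continuous_on S (invariants l)"
  unfolding invariants_def divide_inverse by (intro continuous_intros)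

context smooth_lift
begin

text \<open>\<open>Q\<close> may rest on an arbitrary choice of representative because
  \<open>invariants l\<close> is constant on orbits. Its continuity is local: near each point it is
  \<open>invariants l\<close> after \<open>polar\<close> after the coordinate representation of
  \<open>f\<close>, in charts centred at the point and at a representative of its image.\<close>

lemma continuous_on_invariants_f:
  obtains Q where "continuous_on einstein Q"
    "\<And>x y. x \<in> einstein \<Longrightarrow> y \<in> einstein \<Longrightarrow> proj l y = f (proj m x) \<Longrightarrow> Q x = invariants l y"
proof -
  define Q where "Q x = invariants l (SOME y. y \<in> einstein \<and> proj l y = f (proj m x))" for x
  have Q: "Q x = invariants l y"
    if "x \<in> einstein" "y \<in> einstein" "proj l y = f (proj m x)" for x y
  proof -
    let ?y = "SOME y. y \<in> einstein \<and> proj l y = f (proj m x)"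
    have "?y \<in> einstein \<and> proj l ?y = f (proj m x)"
      by (rule someI[of _ y]) (simp add: that)
    then have "\<exists>j. ?y = sig (l * j) y" using that proj_eq_iff[of y ?y l] by simp
    then show ?thesis using l by (auto simp: Q_def invariants_sig)
  qed
  have "continuous_on (- {0}) (Q \<circ> polar)"
  proof (intro continuous_at_imp_continuous_on ballI)
    fix z :: 'a assume "z \<in> - {0}"
    then have z: "z \<noteq> 0" "polar z \<in> einstein" by (auto simp: polar_einstein)
    obtain y where y: "y \<in> einstein" "f (proj m (polar z)) = proj l y" using f_proj[OF z(2)] by blast
    define a where "a = ln (norm z)"
    define b where "b = fst y"
    have "z \<in> annulus a" using z(1) by (simp add: annulus_def a_def)
    moreover have "cart y \<in> annulus b" using y(1) by (simp add: cart_annulus b_def)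
    then have "f (proj m (polar z)) \<in> (proj l \<circ> polar) ` annulus b"
      using y by (intro image_eqI[of _ _ "cart y"]) simp_all
    ultimately have zd: "z \<in> rdom a b" by (simp add: dom_eq)
    have "isCont (rep a b) z" using rep_derivative[OF zd] has_derivative_continuous by blast
    moreover have "rep a b z \<noteq> 0" using rep_annulus(1)[OF zd] annulus_subset by blast
    then have "isCont polar (rep a b z)"
      using polar_has_derivative has_derivative_continuous by blast
    ultimately have "isCont (\<lambda>z. polar (rep a b z)) z" by (rule isCont_o2)
    moreover have "isCont (invariants l) y" for y :: "real \<times> 'a"
      using continuous_on_invariants continuous_on_eq_continuous_at open_UNIV by blast
    ultimately have "isCont (\<lambda>z. invariants l (polar (rep a b z))) z" by (rule isCont_o2)
    moreover have "(Q \<circ> polar) w = invariants l (polar (rep a b w))" if "w \<in> rdom a b" for w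
    proof -
      have "w \<noteq> 0" "rep a b w \<noteq> 0"
        using that rep_annulus(1)[OF that] by (auto simp: dom_eq annulus_def)
      then show ?thesis using Q rep_annulus(2)[OF that] by (simp add: polar_einstein)
    qed
    then have "\<forall>\<^sub>F w in nhds z. (Q \<circ> polar) w = invariants l (polar (rep a b w))"
      using open_dom zd eventually_nhds by blast
    ultimately show "isCont (Q \<circ> polar) z" by (rule isCont_cong[THEN iffD2, rotated])
  qed
  then have "continuous_on einstein (\<lambda>x. (Q \<circ> polar) (cart x))"
    by (rule continuous_on_compose2[OF _ continuous_on_cart]) (auto simp: cart_nonzero)
  then have "continuous_on einstein Q" by (rule continuous_on_cong[THEN iffD1, rotated -1]) auto
  then show ?thesis using Q that by blast
qed

text \<open>A continuous logarithm of the circle component fixes the time of the lift, and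
  \<open>sig_of_invariants\<close> then dictates the sphere coordinate. Dimension at least 3 makes
  \<open>einstein\<close> simply connected, so the logarithm exists.\<close>

lemma lift_exists:
  assumes dim: "3 \<le> DIM('a)"
  obtains F where "continuous_on einstein F" "F ` einstein \<subseteq> einstein"
    "\<And>x. x \<in> einstein \<Longrightarrow> proj l (F x) = f (proj m x)"
proof -
  obtain Q where Q: "continuous_on einstein Q"
    "\<And>x y. x \<in> einstein \<Longrightarrow> y \<in> einstein \<Longrightarrow> proj l y = f (proj m x) \<Longrightarrow> Q x = invariants l y"
    using continuous_on_invariants_f by blast
  have "\<exists>y. y \<in> einstein \<and> proj l y = f (proj m x)" if "x \<in> einstein" for x
    using f_proj[OF that] by force
  then obtain Y where Y: "\<And>x. x \<in> einstein \<Longrightarrow> Y x \<in> einstein \<and> proj l (Y x) = f (proj m x)"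
    by metis
  have QY: "Q x = invariants l (Y x)" if "x \<in> einstein" for x using Q(2) Y that by blast
  have "continuous_on einstein (\<lambda>x. fst (Q x))" by (intro continuous_intros Q)
  then obtain g where g: "continuous_on einstein g" "\<And>x. x \<in> einstein \<Longrightarrow> fst (Q x) = exp (g x)"
    by (rule continuous_logarithm_on_simply_connected[OF _ simply_connected_einstein[OF dim]
          locally_path_connected_einstein]) (auto simp: QY invariants_def)
  \<comment> \<open>The circle component of a point with time \<open>t\<close> has angle
    \<open>2 * t / l\<close>; the factor \<open>l / 2\<close> undoes this.\<close>
  define T where "T x = of_int l / 2 * Im (g x)" for x
  define F where "F x = (T x, cos (T x) *\<^sub>R fst (snd (Q x)) + sin (T x) *\<^sub>R snd (snd (Q x)))" for x
  have F: "\<exists>j. F x = sig (l * j) (Y x)" if x: "x \<in> einstein" for x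
  proof -
    have "exp (g x) = cis (2 * fst (Y x) / of_int l)"
      using g(2)[OF x] QY[OF x] by (simp add: invariants_def)
    then have "norm (exp (g x)) = 1" by (simp only: norm_cis)
    then have "Re (g x) = 0" by simp
    then have "exp (g x) = cis (Im (g x))" by (simp add: exp_eq_polar)
    also have "Im (g x) = 2 * T x / of_int l" using l by (simp add: T_def)
    finally have "cis (2 * T x / of_int l) = fst (invariants l (Y x))"
      using g(2)[OF x] QY[OF x] by simp
    then show ?thesis using sig_of_invariants[of l "T x" "Y x"] l by (simp add: F_def QY[OF x])
  qed
  show ?thesis
  proof (rule that[of F])
    show "continuous_on einstein F"
      unfolding F_def T_def by (intro continuous_intros Q g)
    show "F ` einstein \<subseteq> einstein"
    proof (rule image_subsetI)
      fix x :: "real \<times> 'a" assume x: "x \<in> einstein"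
      obtain j where "F x = sig (l * j) (Y x)" using F[OF x] by blast
      then show "F x \<in> einstein" using Y[OF x] by (simp only: sig_einstein)
    qed
    show "proj l (F x) = f (proj m x)" if x: "x \<in> einstein" for x
    proof -
      obtain j where j: "F x = sig (l * j) (Y x)" using F[OF x] by blast
      then have "F x \<in> einstein" using Y[OF x] by (simp only: sig_einstein)
      then have "proj l (Y x) = proj l (F x)"
        using j Y[OF x] proj_eq_iff by blast
      then show ?thesis using Y[OF x] by simp
    qed
  qed
qed

text \<open>Locally the lift is \<open>polar\<close> after the coordinate representation of
  \<open>f\<close> after \<open>cart\<close>. With \<open>u\<close> the coordinate velocity of
  \<gamma>, the old velocity is \<open>?P u\<close> and the new one \<open>?P' (?D u)\<close>;
  conformality, applied to \<open>u\<close> twice, says that their Lorentz forms differ by a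
  positive factor.\<close>

lemma lift_along_curve:
  assumes cont: "continuous_on einstein F" and F: "F ` einstein \<subseteq> einstein"
    and Fproj: "\<And>x. x \<in> einstein \<Longrightarrow> proj l (F x) = f (proj m x)"
    and \<gamma>: "range \<gamma> \<subseteq> einstein" and der: "(\<gamma> has_vector_derivative v) (at s)"
  obtains v' where "((F \<circ> \<gamma>) has_vector_derivative v') (at s)"
    "conformal_diffeomorphism (sig_quotient m) (sig_quotient l) f \<Longrightarrow> timelike v' \<longleftrightarrow> timelike v"
proof -
  have Fe: "F x \<in> einstein" if "x \<in> einstein" for x using that F by blast
  have \<gamma>e: "\<gamma> t \<in> einstein" for t using \<gamma> by blast
  define z where "z = cart (\<gamma> s)"
  have z: "z \<noteq> 0" "polar z = \<gamma> s" using \<gamma>e by (auto simp: z_def cart_nonzero)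
  define a where "a = fst (\<gamma> s)"
  define b where "b = fst (F (\<gamma> s))"
  \<comment> \<open>On \<open>N\<close> the lift stays in the slab around
    \<open>F (\<gamma> s)\<close>. There the projection is injective, so the representative that
    \<open>inv_into\<close> selects in \<open>rep a b\<close> is the one given by
    \<open>F\<close>.\<close>
  define N where "N = annulus a \<inter> (F \<circ> polar) -` {y. b - pi / 2 < fst y \<and> fst y < b + pi / 2}"
  have "continuous_on (annulus a) (F \<circ> polar)"
    by (intro continuous_on_compose continuous_on_subset[OF continuous_on_polar] annulus_subset
        continuous_on_subset[OF cont]) (auto simp: annulus_def polar_einstein)
  moreover have "open {y :: real \<times> 'a. b - pi / 2 < fst y \<and> fst y < b + pi / 2}"
    by (intro open_Collect_conj open_Collect_less continuous_intros)
  ultimately have N: "open N" unfolding N_def by (intro continuous_open_preimage open_annulus)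
  have zN: "z \<in> N" using z(2) \<gamma>e by (auto simp: N_def z_def cart_annulus a_def b_def)
  have rep: "w \<in> rdom a b" "F (polar w) = polar (rep a b w)" if w: "w \<in> N" for w
  proof -
    have pw: "polar w \<in> einstein" "w \<in> annulus a" using w by (auto simp: N_def annulus_def polar_einstein)
    have c: "cart (F (polar w)) \<in> annulus b" using w Fe[OF pw(1)] by (auto simp: N_def cart_annulus)
    have p: "(proj l \<circ> polar) (cart (F (polar w))) = f (proj m (polar w))"
      using Fe[OF pw(1)] Fproj[OF pw(1)] by simp
    have "f (proj m (polar w)) \<in> (proj l \<circ> polar) ` annulus b"
      using c p by (metis image_eqI)
    then show "w \<in> rdom a b" using pw by (simp add: dom_eq)
    have "rep a b w = cart (F (polar w))"
      unfolding rep_eq p[symmetric] by (rule inv_into_f_f[OF inj_on_proj_polar[OF l] c])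
    then show "F (polar w) = polar (rep a b w)" using Fe[OF pw(1)] by simp
  qed
  let ?D = "frechet_derivative (rep a b) (at z)"
  let ?P = "frechet_derivative polar (at z)"
  let ?P' = "frechet_derivative polar (at (rep a b z))"
  define u where "u = frechet_derivative cart (at (\<gamma> s)) v"
  have cart_der: "((\<lambda>t. cart (\<gamma> t)) has_derivative (\<lambda>h. h *\<^sub>R u)) (at s)"
  proof -
    have "((\<lambda>t. cart (\<gamma> t)) has_derivative (\<lambda>h. frechet_derivative cart (at (\<gamma> s)) (h *\<^sub>R v))) (at s)"
      using has_derivative_compose[OF der[unfolded has_vector_derivative_def] cart_has_derivative] .
    then show ?thesis
      by (simp add: u_def linear_cmul[OF has_derivative_linear[OF cart_has_derivative]])
  qed
  have "rep a b z \<noteq> 0" using rep_annulus(1)[OF rep(1)[OF zN]] by (auto simp: annulus_def)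
  note P' = polar_has_derivative[OF this]
  have P: "(polar has_derivative ?P) (at (cart (\<gamma> s)))"
    using polar_has_derivative[OF z(1)] by (simp add: z_def)
  have "(rep a b has_derivative ?D) (at (cart (\<gamma> s)))"
    using rep_derivative[OF rep(1)[OF zN]] by (simp add: z_def)
  from has_derivative_compose[OF cart_der this]
  have "((\<lambda>t. rep a b (cart (\<gamma> t))) has_derivative (\<lambda>h. ?D (h *\<^sub>R u))) (at s)" .
  from has_derivative_compose[OF this, of polar ?P'] P'
  have "((\<lambda>t. polar (rep a b (cart (\<gamma> t)))) has_derivative (\<lambda>h. ?P' (?D (h *\<^sub>R u)))) (at s)"
    by (simp add: z_def)
  also have "(\<lambda>h. ?P' (?D (h *\<^sub>R u))) = (\<lambda>h. h *\<^sub>R ?P' (?D u))"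
    by (simp add: linear_cmul[OF has_derivative_linear[OF P']]
        linear_cmul[OF has_derivative_linear[OF rep_derivative[OF rep(1)[OF zN]]]])
  finally have *: "((\<lambda>t. polar (rep a b (cart (\<gamma> t)))) has_derivative (\<lambda>h. h *\<^sub>R ?P' (?D u))) (at s)" .
  have "isCont (\<lambda>t. cart (\<gamma> t)) s" using cart_der has_derivative_continuous by blast
  then have "\<forall>\<^sub>F t in nhds s. cart (\<gamma> t) \<in> N"
    using N zN by (auto simp: z_def continuous_at tendsto_def eventually_at_filter elim!: eventually_mono
        dest!: topological_tendstoD)
  then have ev: "\<forall>\<^sub>F t in nhds s. (F \<circ> \<gamma>) t = polar (rep a b (cart (\<gamma> t)))"
    by eventually_elim (use rep(2) \<gamma>e in force)
  from ev obtain S where S: "open S" "s \<in> S"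
    "\<And>t. t \<in> S \<Longrightarrow> polar (rep a b (cart (\<gamma> t))) = (F \<circ> \<gamma>) t"
    unfolding eventually_nhds by metis
  have 1: "((F \<circ> \<gamma>) has_vector_derivative ?P' (?D u)) (at s)"
    unfolding has_vector_derivative_def by (rule has_derivative_transform_within_open[OF * S])
  \<comment> \<open>\<open>polar\<close> after \<open>cart\<close> is the identity along \<gamma>,
    so uniqueness of the derivative expresses \<open>v\<close> in coordinates.\<close>
  have "((\<lambda>t. polar (cart (\<gamma> t))) has_derivative (\<lambda>h. ?P (h *\<^sub>R u))) (at s)"
    using has_derivative_compose[OF cart_der P] .
  then have "(\<gamma> has_vector_derivative ?P u) (at s)"
    using \<gamma>e by (simp add: has_vector_derivative_def linear_cmul[OF has_derivative_linear[OF P]])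
  then have v: "v = ?P u" using der vector_derivative_unique_at by blast
  show ?thesis
  proof (rule that[OF 1])
    assume "conformal_diffeomorphism (sig_quotient m) (sig_quotient l) f"
    then obtain \<mu> where \<mu>: "\<And>p. p \<in> points (sig_quotient m) \<Longrightarrow> \<mu> p > 0"
      "\<And>c d x v w. c \<in> sig_quotient m \<Longrightarrow> d \<in> sig_quotient l \<Longrightarrow> x \<in> rep_dom c d f \<Longrightarrow>
        metric_coeff d (coord_rep c d f x) (frechet_derivative (coord_rep c d f) (at x) v)
             (frechet_derivative (coord_rep c d f) (at x) w) = \<mu> (param c x) * metric_coeff c x v w"
      unfolding conformal_diffeomorphism_def by blast
    have "lorentz_form (?P' (?D u)) (?P' (?D u)) = \<mu> (proj m (polar z)) * lorentz_form (?P u) (?P u)"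
      using \<mu>(2)[OF quotient_chart_in_sig_quotient[OF m] quotient_chart_in_sig_quotient[OF l]
          rep(1)[OF zN], of u u]
      by (simp add: quotient_chart_def polar_chart_def)
    moreover have "\<mu> (proj m (polar z)) > 0"
      using \<mu>(1) proj_in_points[OF m] z(1) polar_einstein by blast
    ultimately show "timelike (?P' (?D u)) \<longleftrightarrow> timelike v"
      by (auto simp: timelike_def v mult_less_0_iff)
  qed
qed

end

section \<open>Deck transformations and the comparison of two quotients\<close>

lemma integer_valued_continuous_const:
  fixes h :: "'a::topological_space \<Rightarrow> real"
  assumes "connected S" "continuous_on S h" "\<And>x. x \<in> S \<Longrightarrow> h x \<in> \<int>" "x \<in> S" "y \<in> S"
  shows "h x = h y"
proof -
  have "1 \<le> norm (h y - h x)" if xy: "x \<in> S" "y \<in> S" "h y \<noteq> h x" for x y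
  proof -
    obtain i j where "h x = of_int i" "h y = of_int j" using assms(3) xy(1,2) by (metis Ints_cases)
    then show ?thesis using xy(3) by (simp flip: of_int_diff of_int_abs)
  qed
  then have "h constant_on S"
    using continuous_discrete_range_constant[OF assms(1,2)] zero_less_one by metis
  then show ?thesis using assms(4,5) by (auto simp: constant_on_def)
qed

text \<open>The time displacement divided by \<open>m * pi\<close> is continuous and integer valued
  on a connected space, so one exponent serves all points.\<close>

lemma lift_composite_const:
  fixes G F :: "real \<times> 'a::euclidean_space \<Rightarrow> real \<times> 'a"
  assumes "2 \<le> DIM('a)" "m \<ge> 1" "continuous_on einstein H"
    and H: "\<And>x. x \<in> einstein \<Longrightarrow> \<exists>j. H x = sig (m * j) x"
  obtains j where "\<And>x :: real \<times> 'a. x \<in> einstein \<Longrightarrow> H x = sig (m * j) x"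
proof -
  obtain j where j: "\<And>x. x \<in> einstein \<Longrightarrow> H x = sig (m * j x) x" using H by metis
  define h where "h x = (fst (H x) - fst x) / (of_int m * pi)" for x
  have jh: "h x = of_int (j x)" if "x \<in> einstein" for x
    using j[OF that] assms(2) by (simp add: h_def)
  have "continuous_on einstein h"
    unfolding h_def using assms(2) by (intro continuous_intros assms) auto
  then have const: "j x = j y" if "x \<in> einstein" "y \<in> einstein" for x y
    using integer_valued_continuous_const[OF connected_einstein[OF assms(1)] _ _ that, of h] jh that
    by simp
  show ?thesis
  proof (cases "einstein = ({} :: (real \<times> 'a) set)")
    case False
    then obtain x0 :: "real \<times> 'a" where "x0 \<in> einstein" by blast
    then show ?thesis using that[of "j x0"] j const by metis
  qed (use that in auto)
qed

lemma timelike_curve_einstein: "timelike_curve \<gamma> \<Longrightarrow> \<gamma> s \<in> einstein"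
  unfolding timelike_curve_def by blast

theorem sig_quotients_not_conformal:
  assumes dim: "3 \<le> DIM('a::euclidean_space)" and m: "m \<ge> 1" and l: "l \<ge> 1"
    and "conformally_diffeomorphic (sig_quotient m :: 'a einstein_quotient) (sig_quotient l :: 'a einstein_quotient)"
  shows "m = l"
proof -
  have dim2: "2 \<le> DIM('a)" using dim by simp
  obtain f :: "(real \<times> 'a) set \<Rightarrow> (real \<times> 'a) set"
    where conf: "conformal_diffeomorphism (sig_quotient m) (sig_quotient l) f"
    using assms(4) unfolding conformally_diffeomorphic_def by blast
  define g where "g = inv_into (points (sig_quotient m)) f"
  have bij: "bij_betw f (points (sig_quotient m)) (points (sig_quotient l))"
    and fs: "smooth_map (sig_quotient m) (sig_quotient l) f"
    and gs: "smooth_map (sig_quotient l) (sig_quotient m) g"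
    using conf unfolding conformal_diffeomorphism_def diffeomorphism_def g_def by auto
  interpret f: smooth_lift m l f using m l fs by unfold_locales
  interpret g: smooth_lift l m g using m l gs by unfold_locales
  obtain F where F: "continuous_on einstein F" "F ` einstein \<subseteq> einstein"
    "\<And>x. x \<in> einstein \<Longrightarrow> proj l (F x) = f (proj m x)" using f.lift_exists[OF dim] by blast
  obtain G where G: "continuous_on einstein G" "G ` einstein \<subseteq> einstein"
    "\<And>x. x \<in> einstein \<Longrightarrow> proj m (G x) = g (proj l x)" using g.lift_exists[OF dim] by blast
  have Fe: "F x \<in> einstein" and Ge: "G x \<in> einstein" if "x \<in> einstein" for x using that F G by blast+
  have gf: "g (f q) = q" if "q \<in> points (sig_quotient m)" for q
    using bij_betw_inv_into_left[OF bij that] by (simp add: g_def)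
  have fg: "f (g q) = q" if "q \<in> points (sig_quotient l)" for q
    using bij_betw_inv_into_right[OF bij that] by (simp add: g_def)
  \<comment> \<open>The two lifts are chosen independently, so \<open>G \<circ> F\<close> may differ
    from the identity; it covers the identity, hence it is a deck transformation.\<close>
  have "proj m x = proj m (G (F x))" if "x \<in> einstein" for x
    using that by (simp add: F(3) G(3) Fe gf proj_in_points[OF m])
  then have "\<exists>j. (G \<circ> F) x = sig (m * j) x" if "x \<in> einstein" for x
    using proj_eq_iff[OF that Ge[OF Fe[OF that]], of m] that by simp
  then obtain i where i: "\<And>x. x \<in> einstein \<Longrightarrow> (G \<circ> F) x = sig (m * i) x"
    using lift_composite_const[OF dim2 m, of "G \<circ> F"] continuous_on_compose[OF F(1)]
      continuous_on_subset[OF G(1) F(2)] by blast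
  have "proj l x = proj l (F (G x))" if "x \<in> einstein" for x
    using that by (simp add: F(3) G(3) Ge fg proj_in_points[OF l])
  then have "\<exists>j. (F \<circ> G) x = sig (l * j) x" if "x \<in> einstein" for x
    using proj_eq_iff[OF that Fe[OF Ge[OF that]], of l] that by simp
  then obtain k where k: "\<And>x. x \<in> einstein \<Longrightarrow> (F \<circ> G) x = sig (l * k) x"
    using lift_composite_const[OF dim2 l, of "F \<circ> G"] continuous_on_compose[OF G(1)]
      continuous_on_subset[OF F(1) G(2)] by blast
  \<comment> \<open>\<open>F \<circ> G\<close> is a power of \<open>sig\<close>; undoing that power
    first gives a preimage under \<open>F\<close>.\<close>
  have surj: "F ` einstein = einstein"
  proof (intro equalityI F(2) subsetI)
    fix y :: "real \<times> 'a" assume "y \<in> einstein"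
    then show "y \<in> F ` einstein"
      using k[of "sig (- (l * k)) y"] Ge by (intro image_eqI[of _ _ "G (sig (- (l * k)) y)"]) (auto simp: sig_sig)
  qed
  have Fcurve: "timelike_curve (F \<circ> \<gamma>)" if \<gamma>: "timelike_curve \<gamma>" for \<gamma>
    unfolding timelike_curve_def
  proof (intro conjI allI)
    show "range (F \<circ> \<gamma>) \<subseteq> einstein"
      by (rule image_subsetI) (simp add: Fe timelike_curve_einstein[OF \<gamma>])
    fix s
    obtain v where "range \<gamma> \<subseteq> einstein" "(\<gamma> has_vector_derivative v) (at s)" "timelike v"
      using \<gamma> unfolding timelike_curve_def by blast
    then show "\<exists>v. ((F \<circ> \<gamma>) has_vector_derivative v) (at s) \<and> timelike v"
      using f.lift_along_curve[OF F] conf by metis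
  qed
  \<comment> \<open>Conformality is known for \<open>f\<close>, so the velocity \<open>v'\<close> of
    \<open>G \<circ> \<gamma>\<close> is tested through \<open>F\<close>: its image
    \<open>v''\<close> is the velocity of \<gamma> moved by a power of \<open>sig\<close>, an
    isometry, and \<open>F\<close> reflects timelike vectors.\<close>
  have Gcurve: "timelike_curve (G \<circ> \<gamma>)" if \<gamma>: "timelike_curve \<gamma>" for \<gamma>
    unfolding timelike_curve_def
  proof (intro conjI allI)
    show r: "range (G \<circ> \<gamma>) \<subseteq> einstein"
      by (rule image_subsetI) (simp add: Ge timelike_curve_einstein[OF \<gamma>])
    fix s
    obtain v where v: "range \<gamma> \<subseteq> einstein" "(\<gamma> has_vector_derivative v) (at s)" "timelike v"
      using \<gamma> unfolding timelike_curve_def by blast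
    obtain v' where v': "((G \<circ> \<gamma>) has_vector_derivative v') (at s)"
      using g.lift_along_curve[OF G v(1,2)] by metis
    obtain v'' where v'': "((F \<circ> (G \<circ> \<gamma>)) has_vector_derivative v'') (at s)" "timelike v'' \<longleftrightarrow> timelike v'"
      using f.lift_along_curve[OF F r v'] conf by metis
    have "F \<circ> (G \<circ> \<gamma>) = (\<lambda>t. sig (l * k) (\<gamma> t))" using k timelike_curve_einstein[OF \<gamma>] by (simp add: fun_eq_iff)
    moreover have "((\<lambda>t. sig (l * k) (\<gamma> t)) has_vector_derivative
        (fst v, if even (l * k) then snd v else - snd v)) (at s)"
    proof -
      have "((\<lambda>t. fst (\<gamma> t)) has_vector_derivative fst v) (at s)"
        "((\<lambda>t. snd (\<gamma> t)) has_vector_derivative snd v) (at s)"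
        using bounded_linear.has_vector_derivative[OF bounded_linear_fst v(2)]
          bounded_linear.has_vector_derivative[OF bounded_linear_snd v(2)] by auto
      then show ?thesis
        unfolding sig_def
        by (cases "even (l * k)") (auto intro!: has_vector_derivative_Pair derivative_eq_intros simp del: even_mult_iff)
    qed
    ultimately have "v'' = (fst v, if even (l * k) then snd v else - snd v)"
      using v''(1) vector_derivative_unique_at by metis
    then have "timelike v''" using v(3) by (simp add: timelike_def lorentz_form_def)
    then show "\<exists>v. ((G \<circ> \<gamma>) has_vector_derivative v) (at s) \<and> timelike v" using v' v'' by blast
  qed
  have Fchron: "chron (F p) (F q) \<or> chron (F q) (F p)" if pq: "p \<in> einstein" "q \<in> einstein" "chron p q" for p q
  proof -
    obtain \<gamma> where "timelike_curve \<gamma>" "\<gamma> 0 = p" "\<gamma> 1 = q"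
      using chron_timelike_curve[OF pq dim2] .
    then show ?thesis using timelike_curve_chron[OF Fcurve dim2, of \<gamma>] by simp
  qed
  have Gchron: "chron (G p) (G q) \<or> chron (G q) (G p)" if pq: "p \<in> einstein" "q \<in> einstein" "chron p q" for p q
  proof -
    obtain \<gamma> where "timelike_curve \<gamma>" "\<gamma> 0 = p" "\<gamma> 1 = q"
      using chron_timelike_curve[OF pq dim2] .
    then show ?thesis using timelike_curve_chron[OF Gcurve dim2, of \<gamma>] by simp
  qed
  \<comment> \<open>\<open>G \<circ> F\<close> acts on both points by the same power of
    \<open>sig\<close>, under which \<open>chron\<close> is invariant.\<close>
  have reflect: "chron p q \<or> chron q p" if "p \<in> einstein" "q \<in> einstein" "chron (F p) (F q)" for p q
    using Gchron[OF Fe[OF that(1)] Fe[OF that(2)] that(3)] i[OF that(1)] i[OF that(2)] by simp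
  have asym: "\<not> chron q p" if "p \<in> einstein" "q \<in> einstein" "chron p q" for p q :: "real \<times> 'a"
    using that chron_imp_less by (meson less_asym)
  have "(\<forall>p\<in>einstein. \<forall>q\<in>einstein. chron (F p) (F q) \<longleftrightarrow> chron p q) \<or>
        (\<forall>p\<in>einstein. \<forall>q\<in>einstein. chron (F p) (F q) \<longleftrightarrow> chron q p)"
    using chron_uniform_orientation[OF F(1,2) Fchron dim2]
  proof
    assume fwd: "\<forall>p\<in>einstein. \<forall>q\<in>einstein. chron p q \<longrightarrow> chron (F p) (F q)"
    \<comment> \<open>\<open>reflect\<close> returns a relation in one order or the other; asymmetry
      of \<open>chron\<close> excludes the wrong one.\<close>
    have "chron (F p) (F q) \<longleftrightarrow> chron p q" if pq: "p \<in> einstein" "q \<in> einstein" for p q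
      using fwd[rule_format, OF pq] fwd[rule_format, OF pq(2,1)] reflect[OF pq]
        asym[OF Fe[OF pq(1)] Fe[OF pq(2)]] by argo
    then show ?thesis by blast
  next
    assume bwd: "\<forall>p\<in>einstein. \<forall>q\<in>einstein. chron p q \<longrightarrow> chron (F q) (F p)"
    have "chron (F p) (F q) \<longleftrightarrow> chron q p" if pq: "p \<in> einstein" "q \<in> einstein" for p q
      using bwd[rule_format, OF pq] bwd[rule_format, OF pq(2,1)] reflect[OF pq]
        asym[OF Fe[OF pq(1)] Fe[OF pq(2)]] by argo
    then show ?thesis by blast
  qed
  then obtain e where e: "\<bar>e\<bar> = 1" "\<And>j x. x \<in> einstein \<Longrightarrow> F (sig j x) = sig (e * j) (F x)"
    using chron_monotone_commutes_sig[OF surj dim2] by metis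
  \<comment> \<open>One point suffices, as the exponent of a power of \<open>sig\<close> can be read
    off from the image of any point.\<close>
  obtain b :: 'a where "b \<in> Basis" using nonempty_Basis by blast
  then have x: "(0, b) \<in> einstein" (is "?x \<in> _") by (simp add: einstein_iff)
  have "l dvd e * m"
  proof -
    \<comment> \<open>\<open>F\<close> covers \<open>f\<close>, so it sends two points of one orbit
      of \<open>sig m\<close> into one orbit of \<open>sig l\<close>.\<close>
    have "proj m ?x = proj m (sig m ?x)" using proj_sig[OF x, of m 1] by simp
    then have "proj l (F ?x) = proj l (F (sig m ?x))" using x F(3) by simp
    then obtain j where "F (sig m ?x) = sig (l * j) (F ?x)" using proj_eq_iff[of "F ?x" "F (sig m ?x)" l] x Fe
      by (metis sig_einstein)
    then show ?thesis using e(2)[OF x, of m] by auto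
  qed
  moreover have "m dvd e * l"
  proof -
    \<comment> \<open>\<open>e\<close> is its own inverse, so \<open>sig (e * l) ?x\<close> is sent
      into the orbit of \<open>F ?x\<close> under \<open>sig l\<close>; injectivity of
      \<open>f\<close> pulls this back to the source.\<close>
    have "e * (e * l) = l" using e(1) by (auto simp: abs_if split: if_splits)
    then have "F (sig (e * l) ?x) = sig l (F ?x)" using e(2)[OF x] by simp
    then have "proj l (F ?x) = proj l (F (sig (e * l) ?x))"
      using proj_sig[OF Fe[OF x], of l 1] by simp
    then have "f (proj m ?x) = f (proj m (sig (e * l) ?x))" using x F(3) by simp
    then have "proj m ?x = proj m (sig (e * l) ?x)"
      using gf proj_in_points[OF m] x by (metis sig_einstein)
    then obtain j where "sig (e * l) ?x = sig (m * j) ?x"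
      using x proj_eq_iff[of ?x "sig (e * l) ?x" m] by auto
    then show ?thesis by auto
  qed
  ultimately have "l dvd m" "m dvd l" using e(1) by (auto simp: abs_if split: if_splits)
  then show ?thesis using m l zdvd_antisym_nonneg by auto
qed

theorem proposition7:
  fixes n :: nat
  assumes "CARD('d::finite) = n + 1"
    and "n \<ge> 2"
  shows "(\<forall>k h. k \<ge> 1 \<and> h \<ge> 1 \<and> k \<noteq> h \<longrightarrow>
            \<not> conformally_diffeomorphic
                (compact_form_I k :: (real ^ 'd) einstein_quotient)
                (compact_form_I h :: (real ^ 'd) einstein_quotient)) \<and>
         (odd n \<longrightarrow> (\<forall>k h. k \<noteq> h \<longrightarrow>
            \<not> conformally_diffeomorphic
                (compact_form_II k :: (real ^ 'd) einstein_quotient)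
                (compact_form_II h :: (real ^ 'd) einstein_quotient))) \<and>
         (odd n \<longrightarrow> (\<forall>k h. h \<ge> 1 \<longrightarrow>
            \<not> conformally_diffeomorphic
                (compact_form_II k :: (real ^ 'd) einstein_quotient)
                (compact_form_I h :: (real ^ 'd) einstein_quotient)))"
proof -
  have "3 \<le> DIM(real ^ 'd)" using assms by simp
  note * = sig_quotients_not_conformal[OF this]
  show ?thesis
  proof (intro conjI impI allI notI)
    fix k h :: nat
    assume kh: "1 \<le> k \<and> 1 \<le> h \<and> k \<noteq> h"
      and c: "conformally_diffeomorphic (compact_form_I k :: (real ^ 'd) einstein_quotient)
        (compact_form_I h :: (real ^ 'd) einstein_quotient)"
    have "2 * int k = 2 * int h" using kh by (intro *[OF _ _ c[unfolded compact_form_I_eq]]) simp_all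
    with kh show False by simp
  next
    fix k h :: nat
    assume kh: "k \<noteq> h"
      and c: "conformally_diffeomorphic (compact_form_II k :: (real ^ 'd) einstein_quotient)
        (compact_form_II h :: (real ^ 'd) einstein_quotient)"
    have "2 * int k + 1 = 2 * int h + 1" by (intro *[OF _ _ c[unfolded compact_form_II_eq]]) simp_all
    with kh show False by simp
  next
    fix k h :: nat
    assume h: "1 \<le> h"
      and c: "conformally_diffeomorphic (compact_form_II k :: (real ^ 'd) einstein_quotient)
        (compact_form_I h :: (real ^ 'd) einstein_quotient)"
    have "2 * int k + 1 = 2 * int h"
      using h by (intro *[OF _ _ c[unfolded compact_form_I_eq compact_form_II_eq]]) simp_all
    \<comment> \<open>Equal exponents would be odd and even at once.\<close>
    then show False by presburger
  qed
qed

end
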